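(* Let $p > 1951$ be a prime. If $x, y \in \mathbb{Z}$ satisfy $x^2 - 2 = y^p$, then $y = -1$. *)

theory Defs
  imports Main "HOL-Computational_Algebra.Primes"
begin

end

theory Submission
  imports Defs Complex_Main "Jordan_Normal_Form.Determinant"
begin

text \<open>
  If \<open>y \<noteq> -1\<close>, then \<open>y \<ge> 7\<close>, and unique factorisation in \<open>\<int>[\<surd>2]\<close> gives
  \<open>x + \<surd>2 = \<epsilon>\<^sup>r \<alpha>\<^sup>p\<close> with \<open>\<epsilon> = 1 + \<surd>2\<close>, \<open>\<bar>r\<bar> < p / 2\<close> and \<open>\<alpha> \<alpha>' = \<plusminus>y\<close>. With \<open>u = ln (\<epsilon>\<^sup>2)\<close> and
  \<open>v = ln \<bar>\<alpha> / \<alpha>'\<bar>\<close>, the linear form \<open>r u + p v = ln ((x + \<surd>2) / (x - \<surd>2))\<close> is positive and of size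
  \<open>y powr (- p / 2)\<close>. Interpolation determinants in the style of Laurent exclude this. The points are
  pairs \<open>(j, i)\<close> of integers, the functions are \<open>C(z, k)\<close> times \<open>exp (l t)\<close>, \<open>k < K\<close>, \<open>\<bar>l\<bar> \<le> 2\<close>,
  where \<open>z = p i - r j\<close> and \<open>t = i u + j v\<close>, so that \<open>t\<close> is almost equal to \<open>u z / p\<close>.
  Conjugation in \<open>\<int>[\<surd>2]\<close> maps \<open>t\<close> to \<open>-t\<close>; in the basis of hyperbolic functions the determinant is
  therefore rational with denominator a power of \<open>y\<close>. Working over \<open>\<rat>\<close> instead of the quadratic
  field is what makes the constants good enough for \<open>p > 1951\<close>.
  A zero estimate makes the determinant nonzero for suitable points, and as
  the functions are almost functions of the single variable \<open>z\<close>, the determinant is too small.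
\<close>

section \<open>Arithmetic of Z[sqrt 2]\<close>

datatype zsqrt2 = ZSqrt2 (rat_part: int) (irr_part: int)

instantiation zsqrt2 :: comm_ring_1
begin

definition "0 = ZSqrt2 0 0"
definition "1 = ZSqrt2 1 0"
definition "a + b = ZSqrt2 (rat_part a + rat_part b) (irr_part a + irr_part b)"
definition "a - b = ZSqrt2 (rat_part a - rat_part b) (irr_part a - irr_part b)"
definition "- a = ZSqrt2 (- rat_part a) (- irr_part a)"
definition "a * b = ZSqrt2 (rat_part a * rat_part b + 2 * irr_part a * irr_part b)
  (rat_part a * irr_part b + irr_part a * rat_part b)"

instance
  by standard (auto simp: zero_zsqrt2_def one_zsqrt2_def plus_zsqrt2_def minus_zsqrt2_def
    uminus_zsqrt2_def times_zsqrt2_def algebra_simps)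

end

lemmas zsqrt2_defs = zero_zsqrt2_def one_zsqrt2_def plus_zsqrt2_def minus_zsqrt2_def
  uminus_zsqrt2_def times_zsqrt2_def

definition real_of_zsqrt2 :: "zsqrt2 \<Rightarrow> real" where
  "real_of_zsqrt2 a = real_of_int (rat_part a) + real_of_int (irr_part a) * sqrt 2"

definition conj_zsqrt2 :: "zsqrt2 \<Rightarrow> zsqrt2" where
  "conj_zsqrt2 a = ZSqrt2 (rat_part a) (- irr_part a)"

definition norm_zsqrt2 :: "zsqrt2 \<Rightarrow> int" where
  "norm_zsqrt2 a = (rat_part a)\<^sup>2 - 2 * (irr_part a)\<^sup>2"

lemma real_of_zsqrt2_mult [simp]: "real_of_zsqrt2 (a * b) = real_of_zsqrt2 a * real_of_zsqrt2 b"
  by (simp add: real_of_zsqrt2_def zsqrt2_defs algebra_simps)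

lemma real_of_zsqrt2_one [simp]: "real_of_zsqrt2 1 = 1"
  by (simp add: real_of_zsqrt2_def zsqrt2_defs)

lemma real_of_zsqrt2_uminus [simp]: "real_of_zsqrt2 (- a) = - real_of_zsqrt2 a"
  by (simp add: real_of_zsqrt2_def zsqrt2_defs algebra_simps)

lemma real_of_zsqrt2_power [simp]: "real_of_zsqrt2 (a ^ n) = real_of_zsqrt2 a ^ n"
  by (induction n) auto

lemma conj_zsqrt2_mult [simp]: "conj_zsqrt2 (a * b) = conj_zsqrt2 a * conj_zsqrt2 b"
  by (simp add: conj_zsqrt2_def zsqrt2_defs algebra_simps)

lemma conj_zsqrt2_one [simp]: "conj_zsqrt2 1 = 1"
  by (simp add: conj_zsqrt2_def zsqrt2_defs)

lemma conj_zsqrt2_power [simp]: "conj_zsqrt2 (a ^ n) = conj_zsqrt2 a ^ n"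
  by (induction n) auto

lemma norm_zsqrt2_mult [simp]: "norm_zsqrt2 (a * b) = norm_zsqrt2 a * norm_zsqrt2 b"
  by (simp add: norm_zsqrt2_def zsqrt2_defs algebra_simps power2_eq_square)

lemma norm_zsqrt2_one [simp]: "norm_zsqrt2 1 = 1"
  by (simp add: norm_zsqrt2_def zsqrt2_defs)

lemma norm_zsqrt2_uminus [simp]: "norm_zsqrt2 (- a) = norm_zsqrt2 a"
  by (simp add: norm_zsqrt2_def zsqrt2_defs)

lemma norm_zsqrt2_power [simp]: "norm_zsqrt2 (a ^ n) = norm_zsqrt2 a ^ n"
  by (induction n) auto

lemma norm_zsqrt2_conj [simp]: "norm_zsqrt2 (conj_zsqrt2 a) = norm_zsqrt2 a"
  by (simp add: norm_zsqrt2_def conj_zsqrt2_def)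

lemma mult_conj_zsqrt2: "a * conj_zsqrt2 a = ZSqrt2 (norm_zsqrt2 a) 0"
  by (simp add: norm_zsqrt2_def conj_zsqrt2_def zsqrt2_defs power2_eq_square algebra_simps)

lemma real_of_zsqrt2_mult_conj:
  "real_of_zsqrt2 a * real_of_zsqrt2 (conj_zsqrt2 a) = real_of_int (norm_zsqrt2 a)"
  by (simp add: real_of_zsqrt2_def conj_zsqrt2_def norm_zsqrt2_def algebra_simps power2_eq_square)

text \<open>Infinite descent: both numbers are even, and their halves satisfy the same equation with
  a smaller \<open>\<bar>b\<bar>\<close>.\<close>

lemma square_eq_twice_square_imp_0:
  fixes a b :: int
  assumes "a\<^sup>2 = 2 * b\<^sup>2"
  shows "b = 0"
  using assms
proof (induction "nat \<bar>b\<bar>" arbitrary: a b rule: less_induct)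
  case less
  have "even (a\<^sup>2)" using less.prems by simp
  then obtain c where c: "a = 2 * c" by (auto elim: evenE)
  have bc: "b\<^sup>2 = 2 * c\<^sup>2" using less.prems c by (simp add: power2_eq_square)
  then have "even (b\<^sup>2)" by simp
  then obtain d where d: "b = 2 * d" by (auto elim: evenE)
  have cd: "c\<^sup>2 = 2 * d\<^sup>2" using bc d by (simp add: power2_eq_square)
  show ?case
  proof (rule ccontr)
    assume "b \<noteq> 0"
    then have "nat \<bar>d\<bar> < nat \<bar>b\<bar>" using d by auto
    from less.hyps[OF this cd] d \<open>b \<noteq> 0\<close> show False by simp
  qed
qed

lemma norm_zsqrt2_eq_0_iff [simp]: "norm_zsqrt2 a = 0 \<longleftrightarrow> a = 0"
proof
  assume "norm_zsqrt2 a = 0"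
  then have h: "(rat_part a)\<^sup>2 = 2 * (irr_part a)\<^sup>2" by (simp add: norm_zsqrt2_def)
  from square_eq_twice_square_imp_0[OF h] h show "a = 0"
    by (cases a) (simp add: zsqrt2_defs)
qed (simp add: norm_zsqrt2_def zsqrt2_defs)

section \<open>Euclidean division and Bezout identities in Z[sqrt 2]\<close>

lemma exists_nearest_multiple:
  fixes c n :: int
  assumes "n \<noteq> 0"
  shows "\<exists>q. 2 * \<bar>c - n * q\<bar> \<le> \<bar>n\<bar>"
proof -
  define q where "q = round (real_of_int c / real_of_int n)"
  have "\<bar>real_of_int q - real_of_int c / real_of_int n\<bar> \<le> 1 / 2"
    unfolding q_def by (rule of_int_round_abs_le)
  from mult_left_mono[OF this, of "2 * \<bar>real_of_int n\<bar>"]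
  have "2 * \<bar>real_of_int n * (real_of_int q - real_of_int c / real_of_int n)\<bar> \<le> \<bar>real_of_int n\<bar>"
    by (simp add: abs_mult)
  also have "real_of_int n * (real_of_int q - real_of_int c / real_of_int n) = real_of_int (n * q - c)"
    using assms by (simp add: field_simps)
  finally have "2 * \<bar>n * q - c\<bar> \<le> \<bar>n\<bar>" by linarith
  then show ?thesis by (intro exI[of _ q]) (simp add: abs_minus_commute)
qed

text \<open>Round both coordinates of a / b to nearest integers. The error s + t sqrt 2 has |s|, |t|
  at most 1/2, so its norm s^2 - 2 t^2 lies in [-1/2, 1/4].\<close>

lemma zsqrt2_division:
  assumes "b \<noteq> 0"
  shows "\<exists>q. \<bar>norm_zsqrt2 (a - b * q)\<bar> < \<bar>norm_zsqrt2 b\<bar>"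
proof -
  define n where "n = norm_zsqrt2 b"
  have n: "n \<noteq> 0" using assms by (simp add: n_def)
  define c where "c = a * conj_zsqrt2 b"
  obtain q1 q2 where q: "2 * \<bar>rat_part c - n * q1\<bar> \<le> \<bar>n\<bar>" "2 * \<bar>irr_part c - n * q2\<bar> \<le> \<bar>n\<bar>"
    using exists_nearest_multiple[OF n] by metis
  define q where "q = ZSqrt2 q1 q2"
  have "(a - b * q) * conj_zsqrt2 b = c - ZSqrt2 n 0 * q"
    unfolding c_def n_def mult_conj_zsqrt2[symmetric] by (simp add: algebra_simps)
  also have "\<dots> = ZSqrt2 (rat_part c - n * q1) (irr_part c - n * q2)"
    by (simp add: q_def zsqrt2_defs)
  finally have "norm_zsqrt2 (a - b * q) * n
      = (rat_part c - n * q1)\<^sup>2 - 2 * (irr_part c - n * q2)\<^sup>2"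
    using norm_zsqrt2_mult[of "a - b * q" "conj_zsqrt2 b"]
    by (simp add: n_def) (simp add: norm_zsqrt2_def)
  moreover have "4 * (rat_part c - n * q1)\<^sup>2 \<le> n\<^sup>2" "4 * (irr_part c - n * q2)\<^sup>2 \<le> n\<^sup>2"
    using power_mono[OF q(1), of 2] power_mono[OF q(2), of 2] by (simp_all add: power_mult_distrib)
  moreover have "n\<^sup>2 > 0" using n by simp
  ultimately have "\<bar>norm_zsqrt2 (a - b * q) * n\<bar> < n\<^sup>2"
    using zero_le_power2[of "rat_part c - n * q1"] zero_le_power2[of "irr_part c - n * q2"]
    by linarith
  then have "\<bar>norm_zsqrt2 (a - b * q)\<bar> * \<bar>n\<bar> < \<bar>n\<bar> * \<bar>n\<bar>"
    by (simp add: abs_mult power2_eq_square)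
  then have "\<bar>norm_zsqrt2 (a - b * q)\<bar> < \<bar>n\<bar>" by (rule mult_right_less_imp_less) simp
  then show ?thesis by (auto simp: n_def)
qed

text \<open>An element of least absolute norm among the nonzero members of the ideal generated by
  \<open>a\<close> and \<open>c\<close> divides every member, since a nonzero remainder would have
  smaller norm.\<close>

lemma zsqrt2_bezout:
  assumes "a \<noteq> 0"
  shows "\<exists>s t d :: zsqrt2. d = s * a + t * c \<and> d dvd a \<and> d dvd c \<and> d \<noteq> 0"
proof -
  define I where "I = {d. d \<noteq> 0 \<and> (\<exists>s t. d = s * a + t * c)}"
  have "a = 1 * a + 0 * c" by simp
  then have "a \<in> I" unfolding I_def using assms by blast
  then obtain d where d: "d \<in> I" and min: "\<And>e. e \<in> I \<Longrightarrow> nat \<bar>norm_zsqrt2 d\<bar> \<le> nat \<bar>norm_zsqrt2 e\<bar>"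
    using ex_has_least_nat[of "\<lambda>x. x \<in> I" a "\<lambda>x. nat \<bar>norm_zsqrt2 x\<bar>"] by blast
  obtain s t where st: "d = s * a + t * c" and d0: "d \<noteq> 0" using d by (auto simp: I_def)
  have dvd: "d dvd e" if e: "e = s' * a + t' * c" for e s' t'
  proof -
    obtain q where q: "\<bar>norm_zsqrt2 (e - d * q)\<bar> < \<bar>norm_zsqrt2 d\<bar>"
      using zsqrt2_division[OF d0] by blast
    have "e - d * q = (s' - s * q) * a + (t' - t * q) * c"
      unfolding e st by (simp add: algebra_simps)
    then have "e - d * q \<notin> I \<longrightarrow> e - d * q = 0" unfolding I_def by blast
    moreover have "e - d * q \<notin> I" using min[of "e - d * q"] q by auto
    ultimately have "e = d * q" by simp
    then show ?thesis by simp
  qed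
  have "d dvd a" by (rule dvd[of _ 1 0]) simp
  moreover have "d dvd c" by (rule dvd[of _ 0 1]) simp
  ultimately show ?thesis using st d0 by blast
qed

section \<open>Coprime factors of perfect powers\<close>

lemma diff_dvd_power_diff: "(a - b :: 'a :: comm_ring_1) dvd a ^ n - b ^ n"
  by (simp add: power_diff_sumr2)

text \<open>Here \<open>d\<close> is a gcd of \<open>a\<close> and \<open>c\<close>, and
  \<open>a\<close> turns out to be associated to \<open>d ^ n\<close> by Bezout identities alone,
  without prime factorisations. Modulo \<open>a\<close>, \<open>d ^ n\<close> equals
  \<open>(v * c) ^ n\<close>, a multiple of \<open>c ^ n = a * b\<close>.\<close>

lemma power_gcd_of_coprime_factor:
  fixes a b c d :: "'a :: comm_ring_1"
  assumes ab: "a * b = c ^ n" and n: "n > 0" and cop: "s * a + t * b = 1"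
    and d: "d = u * a + v * c" "d dvd a" "d dvd c"
  shows "d ^ n dvd a" "a dvd d ^ n"
proof -
  obtain k where k: "n = Suc k" using n by (cases n) auto
  have "d - v * c dvd d ^ n - (v * c) ^ n" by (rule diff_dvd_power_diff)
  then have "a dvd d ^ n - (v * c) ^ n" using d(1) by (auto dest: dvd_mult_right)
  moreover have "(v * c) ^ n = a * (v ^ n * b)"
    unfolding power_mult_distrib ab[symmetric] by (simp add: mult_ac)
  then have "a dvd (v * c) ^ n" by (metis dvd_triv_left)
  ultimately have "a dvd (d ^ n - (v * c) ^ n) + (v * c) ^ n" by (rule dvd_add)
  then show "a dvd d ^ n" by simp
  have "1 - s * a dvd 1 ^ k - (s * a) ^ k" by (rule diff_dvd_power_diff)
  moreover have "1 - s * a = t * b" using cop by (simp add: algebra_simps)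
  ultimately have "b dvd 1 - (s * a) ^ k" by (auto dest: dvd_mult_right)
  then obtain w where w: "1 - (s * a) ^ k = b * w" by (rule dvdE)
  \<comment> \<open>The first summand is a multiple of \<open>a * b = c ^ n\<close>, because
    \<open>b\<close> divides \<open>1 - (s * a) ^ k\<close>; the second is a multiple of
    \<open>a ^ n\<close>. So \<open>d ^ n\<close> divides both.\<close>
  have "a = a * (1 - (s * a) ^ k) + a * (s * a) ^ k" by (simp add: algebra_simps)
  also have "\<dots> = c ^ n * w + a ^ n * s ^ k"
    unfolding w ab[symmetric] by (simp add: k power_mult_distrib mult_ac)
  also have "d ^ n dvd \<dots>"
    using d(2,3) by (intro dvd_add dvd_mult2 dvd_power_same)
  finally show "d ^ n dvd a" .
qed

section \<open>Units of Z[sqrt 2]\<close>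

text \<open>Integer powers of the fundamental unit 1 + sqrt 2, whose inverse is -1 + sqrt 2.\<close>

definition unit_zsqrt2 :: "int \<Rightarrow> zsqrt2" where
  "unit_zsqrt2 r = (if r \<ge> 0 then ZSqrt2 1 1 ^ nat r else ZSqrt2 (-1) 1 ^ nat (- r))"

lemma real_of_unit_zsqrt2: "real_of_zsqrt2 (unit_zsqrt2 r) = (1 + sqrt 2) powi r"
proof -
  have "real_of_zsqrt2 (ZSqrt2 (-1) 1) = inverse (1 + sqrt 2)"
    by (rule inverse_unique[symmetric]) (simp add: real_of_zsqrt2_def algebra_simps)
  then show ?thesis
    by (auto simp: unit_zsqrt2_def power_int_def) (simp add: real_of_zsqrt2_def)
qed

lemma real_of_conj_unit_zsqrt2: "real_of_zsqrt2 (conj_zsqrt2 (unit_zsqrt2 r)) = (1 - sqrt 2) powi r"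
proof -
  have "real_of_zsqrt2 (conj_zsqrt2 (ZSqrt2 (-1) 1)) = inverse (1 - sqrt 2)"
    by (rule inverse_unique[symmetric]) (simp add: real_of_zsqrt2_def conj_zsqrt2_def algebra_simps)
  then show ?thesis
    by (auto simp: unit_zsqrt2_def power_int_def) (simp add: real_of_zsqrt2_def conj_zsqrt2_def)
qed

text \<open>Irrationality of sqrt 2. Identities between units can therefore be verified in the
  reals, where integer powers obey the usual laws.\<close>

lemma real_of_zsqrt2_inject:
  assumes "real_of_zsqrt2 a = real_of_zsqrt2 b"
  shows "a = b"
proof -
  define k l where "k = rat_part a - rat_part b" and "l = irr_part b - irr_part a"
  have "real_of_int k = real_of_int l * sqrt 2"
    using assms by (simp add: k_def l_def real_of_zsqrt2_def algebra_simps)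
  then have "(real_of_int k)\<^sup>2 = 2 * (real_of_int l)\<^sup>2" by (simp add: power_mult_distrib)
  then have "k\<^sup>2 = 2 * l\<^sup>2" by (metis of_int_eq_iff of_int_mult of_int_numeral of_int_power)
  moreover from square_eq_twice_square_imp_0[OF this] have "l = 0" .
  ultimately show ?thesis by (cases a; cases b) (simp add: k_def l_def)
qed

lemma abs_norm_unit_zsqrt2 [simp]: "\<bar>norm_zsqrt2 (unit_zsqrt2 r)\<bar> = 1"
  by (simp add: unit_zsqrt2_def power_abs) (simp add: norm_zsqrt2_def)

lemma sqrt2_bounds: "7 / 5 < sqrt 2" "sqrt 2 < 3 / 2"
  by (rule real_less_rsqrt real_less_lsqrt; simp add: power2_eq_square)+

text \<open>The conjugate has absolute value at most 1, so the difference of the two, 2 b sqrt 2,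
  lies in [0, 2 + sqrt 2). This leaves b = 0, or b = 1 with a = 0, whose norm is -2.\<close>

lemma unit_eq_1_of_reduced:
  assumes n: "\<bar>norm_zsqrt2 m\<bar> = 1" and m: "1 \<le> real_of_zsqrt2 m" "real_of_zsqrt2 m < 1 + sqrt 2"
  shows "m = 1"
proof -
  define a b where "a = rat_part m" and "b = irr_part m"
  have e: "real_of_zsqrt2 m = a + b * sqrt 2" "real_of_zsqrt2 (conj_zsqrt2 m) = a - b * sqrt 2"
    by (simp_all add: real_of_zsqrt2_def conj_zsqrt2_def a_def b_def)
  note s2 = sqrt2_bounds
  have "\<bar>real_of_zsqrt2 m * real_of_zsqrt2 (conj_zsqrt2 m)\<bar> = 1"
    unfolding real_of_zsqrt2_mult_conj using n by linarith
  then have "\<bar>real_of_zsqrt2 m\<bar> * \<bar>real_of_zsqrt2 (conj_zsqrt2 m)\<bar> = 1" by (simp add: abs_mult)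
  moreover have "1 * \<bar>real_of_zsqrt2 (conj_zsqrt2 m)\<bar> \<le> \<bar>real_of_zsqrt2 m\<bar> * \<bar>real_of_zsqrt2 (conj_zsqrt2 m)\<bar>"
    using m by (intro mult_right_mono) auto
  ultimately have c: "\<bar>a - b * sqrt 2\<bar> \<le> 1" using e by simp
  have "2 * (b * sqrt 2) < 4" "2 * (b * sqrt 2) \<ge> 0"
    using c m s2 unfolding e by linarith+
  then have "b * sqrt 2 < 2 * sqrt 2" "b * sqrt 2 \<ge> 0" using s2 by linarith+
  then have "b < 2" "b \<ge> 0" using s2 by (auto simp: zero_le_mult_iff)
  then consider "b = 0" | "b = 1" by linarith
  then show ?thesis
  proof cases
    case 1
    then have "a = 1" using m c unfolding e by simp
    then show ?thesis using 1 by (cases m) (simp add: a_def b_def zsqrt2_defs)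
  next
    case 2
    then have "a = 0" using m s2 unfolding e by simp
    then show ?thesis using n 2 by (simp add: norm_zsqrt2_def a_def b_def)
  qed
qed

text \<open>A positive unit is scaled into the interval [1, 1 + sqrt 2) by a power of 1 + sqrt 2,
  the exponent being read off from its logarithm; a negative unit is treated through its
  opposite.\<close>

lemma unit_zsqrt2_classification:
  assumes n: "\<bar>norm_zsqrt2 m\<bar> = 1"
  shows "\<exists>r. m = unit_zsqrt2 r \<or> m = - unit_zsqrt2 r"
proof -
  have pos: "\<exists>r. m = unit_zsqrt2 r" if n: "\<bar>norm_zsqrt2 m\<bar> = 1" and m: "real_of_zsqrt2 m > 0" for m
  proof -
    define e where "e = 1 + sqrt 2"
    have e: "e > 1" by (simp add: e_def)
    define r where "r = \<lfloor>log e (real_of_zsqrt2 m)\<rfloor>"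
    have "real_of_int r \<le> log e (real_of_zsqrt2 m)" "log e (real_of_zsqrt2 m) < real_of_int r + 1"
      by (simp_all add: r_def)
    then have "e powr r \<le> real_of_zsqrt2 m" "real_of_zsqrt2 m < e powr (r + 1)"
      using e m by (simp_all add: le_log_iff log_less_iff)
    then have rr: "e powi r \<le> real_of_zsqrt2 m" "real_of_zsqrt2 m < e powi r * e"
      using e by (simp_all add: powr_add powr_real_of_int')
    define k where "k = m * unit_zsqrt2 (- r)"
    have rk: "real_of_zsqrt2 k = real_of_zsqrt2 m / e powi r"
      by (simp add: k_def real_of_unit_zsqrt2 e_def power_int_minus divide_inverse)
    have "k = 1"
    proof (rule unit_eq_1_of_reduced)
      show "\<bar>norm_zsqrt2 k\<bar> = 1" using n by (simp add: k_def abs_mult)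
      have "e powi r > 0" using e by simp
      then show "1 \<le> real_of_zsqrt2 k" "real_of_zsqrt2 k < 1 + sqrt 2"
        using rr e unfolding rk e_def[symmetric] by (simp_all add: field_simps)
    qed
    then have "real_of_zsqrt2 m = e powi r" using rk e by (simp add: field_simps)
    then have "real_of_zsqrt2 m = real_of_zsqrt2 (unit_zsqrt2 r)"
      by (simp add: real_of_unit_zsqrt2 e_def)
    then show ?thesis by (blast dest: real_of_zsqrt2_inject)
  qed
  have "real_of_zsqrt2 m \<noteq> 0"
  proof
    assume "real_of_zsqrt2 m = 0"
    then have "norm_zsqrt2 m = 0" using real_of_zsqrt2_mult_conj[of m] by (simp del: norm_zsqrt2_eq_0_iff)
    then show False using n by (simp del: norm_zsqrt2_eq_0_iff)
  qed
  then consider "real_of_zsqrt2 m > 0" | "real_of_zsqrt2 (- m) > 0" by fastforce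
  then show ?thesis
  proof cases
    case 1
    then show ?thesis using pos[OF n] by blast
  next
    case 2
    then show ?thesis using pos[of "- m"] n by (metis minus_minus norm_zsqrt2_uminus)
  qed
qed

text \<open>Allows the exponent of the unit to be reduced modulo \<open>p\<close>, the multiple of
  \<open>p\<close> being absorbed in a \<open>p\<close>-th power.\<close>

lemma unit_zsqrt2_add_mult: "unit_zsqrt2 (r + int p * q) = unit_zsqrt2 r * unit_zsqrt2 q ^ p"
proof -
  have "1 + sqrt 2 \<noteq> 0" by (smt (verit) real_sqrt_ge_zero)
  then have "real_of_zsqrt2 (unit_zsqrt2 (r + int p * q))
      = real_of_zsqrt2 (unit_zsqrt2 r * unit_zsqrt2 q ^ p)"
    by (simp add: real_of_unit_zsqrt2 power_int_add power_int_mult mult.commute[of "int p"])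
  then show ?thesis by (rule real_of_zsqrt2_inject)
qed

section \<open>From the equation to a unit times a p-th power\<close>

text \<open>An even \<open>x\<close> forces an even \<open>y\<close>, so 4 divides
  \<open>y ^ p\<close>, whereas x^2 - 2 is then 2 modulo 4.\<close>

lemma odd_of_square_minus_2_eq_power:
  fixes x y :: int
  assumes eq: "x\<^sup>2 - 2 = y ^ p" and p: "p > 1"
  shows "odd x"
proof
  assume "even x"
  then obtain k where k: "x = 2 * k" by (auto elim: evenE)
  have "even (y ^ p)" unfolding eq[symmetric] using \<open>even x\<close> by simp
  then have "even y" using p by simp
  then have "2\<^sup>2 dvd y\<^sup>2" by (rule dvd_power_same)
  also have "y\<^sup>2 dvd y ^ p" using p by (intro le_imp_power_dvd) simp
  finally have "4 dvd 4 * k\<^sup>2 - 2" unfolding eq[symmetric] k by (simp add: power_mult_distrib)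
  then show False by presburger
qed

text \<open>The number x + sqrt 2 and its conjugate have product \<open>y ^ p\<close> and are
  coprime, so each is a unit times a \<open>p\<close>-th power.\<close>

lemma zsqrt2_factorisation:
  fixes x y :: int and p :: nat
  assumes eq: "x\<^sup>2 - 2 = y ^ p" and p: "odd p" "p > 1"
  shows "\<exists>a b r :: int. 2 * \<bar>r\<bar> < int p \<and> \<bar>a\<^sup>2 - 2 * b\<^sup>2\<bar> = \<bar>y\<bar>
    \<and> x + sqrt 2 = (1 + sqrt 2) powi r * (a + b * sqrt 2) ^ p
    \<and> x - sqrt 2 = (1 - sqrt 2) powi r * (a - b * sqrt 2) ^ p"
proof -
  have xodd: "odd x" by (rule odd_of_square_minus_2_eq_power[OF eq p(2)])
  define \<xi> where "\<xi> = ZSqrt2 x 1"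
  define c where "c = ZSqrt2 y 0"
  have n\<xi>: "norm_zsqrt2 \<xi> = y ^ p" using eq by (simp add: norm_zsqrt2_def \<xi>_def)
  have ypodd: "odd (y ^ p)" unfolding eq[symmetric] using xodd by simp
  have \<xi>0: "\<xi> \<noteq> 0" using n\<xi> ypodd by (metis even_zero norm_zsqrt2_eq_0_iff)
  have c_pow: "ZSqrt2 y 0 ^ n = ZSqrt2 (y ^ n) 0" for n
    by (induction n) (simp_all add: zsqrt2_defs)
  have prod: "\<xi> * conj_zsqrt2 \<xi> = c ^ p"
    by (simp add: mult_conj_zsqrt2 n\<xi> c_def c_pow)
  obtain s t g where g: "g = s * \<xi> + t * conj_zsqrt2 \<xi>" "g dvd \<xi>" "g dvd conj_zsqrt2 \<xi>"
    using zsqrt2_bezout[OF \<xi>0] by blast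
  have "\<exists>s t. s * \<xi> + t * conj_zsqrt2 \<xi> = 1"
  proof -
    have ndvd: "norm_zsqrt2 g dvd norm_zsqrt2 h" if "g dvd h" for h
      using that by (auto elim!: dvdE)
    \<comment> \<open>The difference is 2 sqrt 2, of norm -8, while the norm of \<open>g\<close>
      also divides the odd number \<open>y ^ p\<close>; hence \<open>g\<close> is a unit.\<close>
    have "g dvd \<xi> - conj_zsqrt2 \<xi>" using g(2,3) by (rule dvd_diff)
    then have "norm_zsqrt2 g dvd norm_zsqrt2 (\<xi> - conj_zsqrt2 \<xi>)" by (rule ndvd)
    also have "\<dots> = - 8" by (simp add: \<xi>_def conj_zsqrt2_def zsqrt2_defs norm_zsqrt2_def)
    finally have "norm_zsqrt2 g dvd 2 ^ 3" by simp
    moreover have "coprime (norm_zsqrt2 g) (2 ^ 3)"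
    proof -
      have "odd (norm_zsqrt2 g)" using ndvd[OF g(2)] n\<xi> ypodd by (metis dvd_trans)
      then show ?thesis by (simp add: coprime_power_right_iff del: power_numeral)
    qed
    ultimately have u: "is_unit (norm_zsqrt2 g)" using coprime_common_divisor[OF _ dvd_refl] by metis
    have "norm_zsqrt2 g * norm_zsqrt2 g = 1" using u by (metis abs_mult_self_eq mult_1 zdvd1_eq)
    then have "g * (conj_zsqrt2 g * ZSqrt2 (norm_zsqrt2 g) 0) = 1"
      unfolding mult.assoc[symmetric] mult_conj_zsqrt2 by (simp add: zsqrt2_defs)
    then have "(s * (conj_zsqrt2 g * ZSqrt2 (norm_zsqrt2 g) 0)) * \<xi>
        + (t * (conj_zsqrt2 g * ZSqrt2 (norm_zsqrt2 g) 0)) * conj_zsqrt2 \<xi> = 1"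
      by (subst (asm) (1) g(1)) (simp add: algebra_simps)
    then show ?thesis by blast
  qed
  then obtain s t where st: "s * \<xi> + t * conj_zsqrt2 \<xi> = 1" by blast
  obtain u v d where d: "d = u * \<xi> + v * c" "d dvd \<xi>" "d dvd c"
    using zsqrt2_bezout[OF \<xi>0] by blast
  have p0: "p > 0" using p by simp
  obtain \<eta> where \<eta>: "\<xi> = d ^ p * \<eta>"
    using power_gcd_of_coprime_factor(1)[OF prod p0 st d] by (auto elim: dvdE)
  obtain \<eta>' where \<eta>': "d ^ p = \<xi> * \<eta>'"
    using power_gcd_of_coprime_factor(2)[OF prod p0 st d] by (auto elim: dvdE)
  have "norm_zsqrt2 \<xi> = norm_zsqrt2 \<xi> * (norm_zsqrt2 \<eta>' * norm_zsqrt2 \<eta>)"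
    using arg_cong[OF \<eta>, of norm_zsqrt2] arg_cong[OF \<eta>', of norm_zsqrt2]
    by (simp only: norm_zsqrt2_mult mult.assoc)
  then have "norm_zsqrt2 \<eta>' * norm_zsqrt2 \<eta> = 1" using \<xi>0 by simp
  then have n\<eta>: "\<bar>norm_zsqrt2 \<eta>\<bar> = 1" by (auto simp: zmult_eq_1_iff)
  have "\<bar>norm_zsqrt2 d\<bar> ^ p = \<bar>y\<bar> ^ p"
    using arg_cong[OF \<eta>, of "\<lambda>z. \<bar>norm_zsqrt2 z\<bar>"] n\<eta> n\<xi> by (simp add: abs_mult power_abs)
  then have nd: "\<bar>norm_zsqrt2 d\<bar> = \<bar>y\<bar>" using p0 by (simp add: power_eq_iff_eq_base)
  obtain R where R: "\<eta> = unit_zsqrt2 R \<or> \<eta> = - unit_zsqrt2 R"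
    using unit_zsqrt2_classification[OF n\<eta>] by blast
  obtain q where q: "2 * \<bar>R - int p * q\<bar> \<le> \<bar>int p\<bar>"
    using exists_nearest_multiple[of "int p" R] p0 by auto
  define r where "r = R - int p * q"
  \<comment> \<open>Equality is excluded because \<open>p\<close> is odd.\<close>
  have r: "2 * \<bar>r\<bar> < int p" using q p(1) unfolding r_def by presburger
  have uR: "unit_zsqrt2 R = unit_zsqrt2 r * unit_zsqrt2 q ^ p"
    using unit_zsqrt2_add_mult[of r p q] by (simp add: r_def)
  obtain \<alpha> where \<alpha>: "\<xi> = unit_zsqrt2 r * \<alpha> ^ p" "\<bar>norm_zsqrt2 \<alpha>\<bar> = \<bar>y\<bar>"
    using R
  proof
    assume h: "\<eta> = unit_zsqrt2 R"
    show thesis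
      by (rule that[of "d * unit_zsqrt2 q"]) (simp_all add: \<eta> h uR nd abs_mult power_mult_distrib mult_ac)
  next
    \<comment> \<open>Oddness of \<open>p\<close> moves the sign into the \<open>p\<close>-th
      power.\<close>
    assume h: "\<eta> = - unit_zsqrt2 R"
    show thesis
      by (rule that[of "- (d * unit_zsqrt2 q)"])
        (use p in \<open>simp_all add: \<eta> h uR nd abs_mult power_mult_distrib mult_ac\<close>)
  qed
  define a b where "a = rat_part \<alpha>" and "b = irr_part \<alpha>"
  have "real_of_zsqrt2 \<xi> = (1 + sqrt 2) powi r * (a + b * sqrt 2) ^ p"
    unfolding \<alpha>(1) by (simp add: real_of_unit_zsqrt2) (simp add: real_of_zsqrt2_def a_def b_def)
  moreover have "real_of_zsqrt2 (conj_zsqrt2 \<xi>) = (1 - sqrt 2) powi r * (a - b * sqrt 2) ^ p"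
    unfolding \<alpha>(1) by (simp add: real_of_conj_unit_zsqrt2)
      (simp add: real_of_zsqrt2_def conj_zsqrt2_def a_def b_def)
  moreover have "\<bar>a\<^sup>2 - 2 * b\<^sup>2\<bar> = \<bar>y\<bar>" using \<alpha>(2) by (simp add: norm_zsqrt2_def a_def b_def)
  ultimately show ?thesis
    using r by (intro exI[of _ a] exI[of _ b] exI[of _ r])
      (simp add: \<xi>_def real_of_zsqrt2_def conj_zsqrt2_def)
qed

section \<open>Interpolation determinants\<close>

text \<open>Induction on \<open>n\<close>: expanded along the row of a new point x, the determinant
  is a combination of the \<open>f j x\<close> whose last coefficient is the previous nonzero
  determinant. Independence on \<open>P\<close> supplies an x at which it does not vanish.\<close>

lemma exists_points_det_ne_0:
  fixes f :: "nat \<Rightarrow> 'a \<Rightarrow> real"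
  assumes "\<And>c. (\<And>x. x \<in> P \<Longrightarrow> (\<Sum>j<n. c j * f j x) = 0) \<Longrightarrow> \<forall>j<n. c j = 0"
  shows "\<exists>xs. (\<forall>i<n. xs i \<in> P) \<and> det (mat n n (\<lambda>(i, j). f j (xs i))) \<noteq> 0"
  using assms
proof (induction n)
  case 0
  have "det (mat 0 0 (\<lambda>(i, j). f j (undefined i))) = 1" by (rule det_dim_zero) auto
  then show ?case by (intro exI[of _ undefined]) simp
next
  case (Suc n)
  have "\<forall>j<n. c j = 0" if c: "\<And>x. x \<in> P \<Longrightarrow> (\<Sum>j<n. c j * f j x) = 0" for c
  proof -
    have "\<forall>j<Suc n. (if j < n then c j else 0) = 0"
      by (rule Suc.prems) (use c in simp)
    then show ?thesis by (auto split: if_splits)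
  qed
  from Suc.IH[OF this] obtain xs where xs: "\<forall>i<n. xs i \<in> P"
    and d: "det (mat n n (\<lambda>(i, j). f j (xs i))) \<noteq> 0" by blast
  define A where "A x = mat (Suc n) (Suc n) (\<lambda>(i, j). f j ((xs(n := x)) i))" for x
  define c where "c j = cofactor (A undefined) n j" for j
  \<comment> \<open>Cofactors of the last row ignore that row, so they do not depend on the point
    placed there.\<close>
  have cof: "cofactor (A x) n j = c j" if "j < Suc n" for x j
    unfolding c_def cofactor_def mat_delete_def A_def
    by (rule arg_cong[where f = "\<lambda>M. _ * det M"]) (use that in \<open>auto intro!: eq_matI\<close>)
  have detA: "det (A x) = (\<Sum>j<Suc n. c j * f j x)" for x
  proof -
    have "det (A x) = (\<Sum>j<Suc n. A x $$ (n, j) * cofactor (A x) n j)"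
      by (rule laplace_expansion_row) (auto simp: A_def)
    also have "\<dots> = (\<Sum>j<Suc n. c j * f j x)"
      by (rule sum.cong[OF refl]) (subst cof, auto simp: A_def)
    finally show ?thesis .
  qed
  have "c n = det (mat n n (\<lambda>(i, j). f j (xs i)))"
    unfolding c_def cofactor_def mat_delete_def A_def
    by (auto intro!: arg_cong[where f = det] eq_matI)
  then have "\<not> (\<forall>j<Suc n. c j = 0)" using d by auto
  then have "\<exists>x\<in>P. (\<Sum>j<Suc n. c j * f j x) \<noteq> 0"
    using Suc.prems[of c] by blast
  then obtain x where x: "x \<in> P" "det (A x) \<noteq> 0"
    unfolding detA by blast
  show ?case
    by (rule exI[of _ "xs(n := x)"]) (use x xs in \<open>auto simp: A_def less_Suc_eq\<close>)
qed

text \<open>The values below \<open>N\<close> that \<open>g\<close> omits are as many as the indices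
  where \<open>g\<close> equals \<open>N\<close>, and each of them is smaller than
  \<open>N\<close>.\<close>

lemma sum_ge_triangle_of_partial_inj:
  fixes g :: "nat \<Rightarrow> nat"
  assumes g: "g \<in> {0..<N} \<rightarrow> {..N}" and inj: "inj_on g {i \<in> {0..<N}. g i < N}"
  shows "\<Sum>{..<N} \<le> (\<Sum>i=0..<N. g i)"
proof -
  define I where "I = {i \<in> {0..<N}. g i < N}"
  have [simp]: "finite I" by (simp add: I_def)
  have sub: "g ` I \<subseteq> {..<N}" by (auto simp: I_def)
  have ci: "card (g ` I) = card I" using inj by (simp add: I_def card_image)
  have "\<Sum>{..<N} = (\<Sum>n\<in>g ` I. n) + (\<Sum>n\<in>{..<N} - g ` I. n)"
    using sum.subset_diff[OF sub, of "\<lambda>n. n"] by simp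
  also have "(\<Sum>n\<in>{..<N} - g ` I. n) \<le> (\<Sum>n\<in>{..<N} - g ` I. N)"
    by (rule sum_mono) auto
  also have "\<dots> = (\<Sum>i\<in>{0..<N} - I. N)"
  proof -
    have "card ({..<N} - g ` I) = N - card I" using sub by (simp add: card_Diff_subset ci)
    moreover have "card ({0..<N} - I) = N - card I"
      by (subst card_Diff_subset) (auto simp: I_def)
    ultimately show ?thesis by simp
  qed
  also have "\<dots> = (\<Sum>i\<in>{0..<N} - I. g i)"
    by (rule sum.cong) (use g in \<open>auto simp: I_def le_less\<close>)
  also have "(\<Sum>n\<in>g ` I. n) = (\<Sum>i\<in>I. g i)"
    using inj by (simp add: I_def sum.reindex)
  also have "(\<Sum>i\<in>I. g i) + (\<Sum>i\<in>{0..<N} - I. g i) = (\<Sum>i=0..<N. g i)"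
    by (subst add.commute, rule sum.subset_diff[symmetric]) (auto simp: I_def)
  finally show ?thesis by simp
qed

text \<open>Expand every row: by the rank one condition a choice of indices that repeats some \<open>n < N\<close>
  contributes nothing, so every surviving choice carries at least \<open>0 + 1 + \<dots> + (N - 1)\<close> factors
  \<open>1 / \<rho>\<close>. This finite argument replaces the Schwarz lemma.\<close>

lemma abs_det_le_of_expansion:
  fixes A b a :: "nat \<Rightarrow> nat \<Rightarrow> real" and T :: "nat \<Rightarrow> nat \<Rightarrow> nat \<Rightarrow> real" and \<rho> :: real
  assumes A: "\<And>i j. i < N \<Longrightarrow> j < N \<Longrightarrow> A i j = (\<Sum>n\<le>N. T i j n)"
    and rank1: "\<And>i j n. i < N \<Longrightarrow> j < N \<Longrightarrow> n < N \<Longrightarrow> T i j n = b i n * a n j"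
    and T: "\<And>i j n. i < N \<Longrightarrow> j < N \<Longrightarrow> n \<le> N \<Longrightarrow> \<bar>T i j n\<bar> \<le> \<tau> j n / \<rho> ^ n"
    and \<tau>: "\<And>j. j < N \<Longrightarrow> (\<Sum>n\<le>N. \<tau> j n) \<le> F j"
    and \<rho>: "\<rho> \<ge> 1"
  shows "\<bar>det (mat N N (\<lambda>(i, j). A i j))\<bar> \<le> fact N * (\<Prod>j<N. F j) / \<rho> ^ (\<Sum>{..<N})"
proof -
  define G where "G = (\<Pi>\<^sub>E i\<in>{0..<N}. {..N})"
  define S where "S = {\<sigma>. \<sigma> permutes {0..<N}}"
  define D where "D g = det (mat N N (\<lambda>(i, j). T i j (g i)))" for g
  have finS: "finite S" by (simp add: S_def finite_permutations)
  have finG: "finite G" by (auto simp: G_def intro!: finite_PiE)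
  have less: "\<sigma> i < N" if "\<sigma> \<in> S" "i < N" for \<sigma> i
    using that permutes_in_image[of \<sigma> "{0..<N}" i] by (auto simp: S_def)
  have \<tau>0: "\<tau> j n \<ge> 0" if "j < N" "n \<le> N" for j n
  proof -
    have "0 \<le> \<tau> j n / \<rho> ^ n" using T[of j j n] that by (meson abs_ge_zero order_trans)
    moreover have "\<rho> ^ n > 0" using \<rho> by simp
    ultimately show ?thesis by (simp add: zero_le_divide_iff)
  qed
  have Dsum: "D g = (\<Sum>\<sigma>\<in>S. signof \<sigma> * (\<Prod>i=0..<N. T i (\<sigma> i) (g i)))" for g
    unfolding D_def S_def by (subst det_def'[of _ N]) (auto intro!: sum.cong prod.cong simp: permutes_in_image)
  have "det (mat N N (\<lambda>(i, j). A i j)) = (\<Sum>\<sigma>\<in>S. signof \<sigma> * (\<Prod>i=0..<N. A i (\<sigma> i)))"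
    unfolding S_def by (subst det_def'[of _ N]) (auto intro!: sum.cong prod.cong simp: permutes_in_image)
  also have "\<dots> = (\<Sum>\<sigma>\<in>S. signof \<sigma> * (\<Sum>g\<in>G. \<Prod>i=0..<N. T i (\<sigma> i) (g i)))"
  proof (rule sum.cong[OF refl])
    fix \<sigma> assume s: "\<sigma> \<in> S"
    have "(\<Prod>i=0..<N. A i (\<sigma> i)) = (\<Prod>i=0..<N. \<Sum>n\<le>N. T i (\<sigma> i) n)"
      by (rule prod.cong) (auto simp: A less[OF s])
    also have "\<dots> = (\<Sum>g\<in>G. \<Prod>i=0..<N. T i (\<sigma> i) (g i))"
      unfolding G_def by (rule prod_sum_PiE) auto
    finally show "signof \<sigma> * (\<Prod>i=0..<N. A i (\<sigma> i))
        = signof \<sigma> * (\<Sum>g\<in>G. \<Prod>i=0..<N. T i (\<sigma> i) (g i))" by simp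
  qed
  also have "\<dots> = (\<Sum>g\<in>G. D g)"
    unfolding Dsum sum_distrib_left by (rule sum.swap)
  finally have det: "det (mat N N (\<lambda>(i, j). A i j)) = (\<Sum>g\<in>G. D g)" .
  have gle: "g i \<le> N" if "g \<in> G" "i < N" for g i
    using that unfolding G_def by (auto dest!: PiE_mem[where x = i])
  have Dle: "\<bar>D g\<bar> \<le> (\<Sum>\<sigma>\<in>S. \<Prod>i=0..<N. \<tau> (\<sigma> i) (g i)) / \<rho> ^ (\<Sum>{..<N})" if g: "g \<in> G" for g
  proof (cases "inj_on g {i \<in> {0..<N}. g i < N}")
    case False
    then obtain i i' where ii: "i < N" "i' < N" "i \<noteq> i'" "g i = g i'" "g i < N"
      by (auto simp: inj_on_def)
    \<comment> \<open>Pull \<open>b i (g i)\<close> out of every row with \<open>g i < N\<close>;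
      rows \<open>i\<close> and \<open>i'\<close> then coincide.\<close>
    define c where "c i = (if g i < N then b i (g i) else 1)" for i
    define r where "r i j = (if g i < N then a (g i) j else T i j (g i))" for i j
    have "D g = det (mat\<^sub>r N N (\<lambda>i. c i \<cdot>\<^sub>v vec N (r i)))"
      unfolding D_def by (rule arg_cong[where f = det], rule eq_matI)
        (auto simp: c_def r_def rank1)
    also have "\<dots> = prod c {0..<N} * det (mat\<^sub>r N N (\<lambda>i. vec N (r i)))"
      by (rule det_rows_mul) auto
    also have "det (mat\<^sub>r N N (\<lambda>i. vec N (r i))) = 0"
      by (rule det_identical_rows[of _ N i i'])
        (use ii in \<open>auto simp: r_def\<close>)
    finally have "D g = 0" by simp
    moreover have "0 \<le> (\<Sum>\<sigma>\<in>S. \<Prod>i=0..<N. \<tau> (\<sigma> i) (g i))"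
      by (intro sum_nonneg prod_nonneg ballI \<tau>0) (simp_all add: less gle[OF g])
    ultimately show ?thesis using \<rho> by simp
  next
    case True
    have gf: "g \<in> {0..<N} \<rightarrow> {..N}" using g by (auto simp: G_def)
    have le: "\<Sum>{..<N} \<le> (\<Sum>i=0..<N. g i)"
      by (rule sum_ge_triangle_of_partial_inj[OF gf True])
    have "\<bar>D g\<bar> \<le> (\<Sum>\<sigma>\<in>S. \<bar>signof \<sigma> * (\<Prod>i=0..<N. T i (\<sigma> i) (g i))\<bar>)"
      unfolding Dsum by (rule sum_abs)
    also have "\<dots> \<le> (\<Sum>\<sigma>\<in>S. (\<Prod>i=0..<N. \<tau> (\<sigma> i) (g i)) / \<rho> ^ (\<Sum>{..<N}))"
    proof (rule sum_mono)
      fix \<sigma> assume s: "\<sigma> \<in> S"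
      have "\<bar>signof \<sigma> * (\<Prod>i=0..<N. T i (\<sigma> i) (g i))\<bar> = (\<Prod>i=0..<N. \<bar>T i (\<sigma> i) (g i)\<bar>)"
        by (simp add: abs_mult abs_prod sign_def)
      also have "\<dots> \<le> (\<Prod>i=0..<N. \<tau> (\<sigma> i) (g i) / \<rho> ^ g i)"
      proof (rule prod_mono, intro conjI)
        fix i assume "i \<in> {0..<N}"
        then show "\<bar>T i (\<sigma> i) (g i)\<bar> \<le> \<tau> (\<sigma> i) (g i) / \<rho> ^ g i"
          by (intro T) (simp_all add: less[OF s] gle[OF g])
      qed simp
      also have "\<dots> = (\<Prod>i=0..<N. \<tau> (\<sigma> i) (g i)) / \<rho> ^ (\<Sum>i=0..<N. g i)"
        by (simp add: prod_dividef power_sum)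
      also have "\<dots> \<le> (\<Prod>i=0..<N. \<tau> (\<sigma> i) (g i)) / \<rho> ^ (\<Sum>{..<N})"
      proof (rule divide_left_mono)
        show "\<rho> ^ (\<Sum>{..<N}) \<le> \<rho> ^ (\<Sum>i=0..<N. g i)" by (rule power_increasing[OF le \<rho>])
        show "0 \<le> (\<Prod>i=0..<N. \<tau> (\<sigma> i) (g i))"
          by (intro prod_nonneg ballI \<tau>0) (simp_all add: less[OF s] gle[OF g])
      qed (use \<rho> in simp)
      finally show "\<bar>signof \<sigma> * (\<Prod>i=0..<N. T i (\<sigma> i) (g i))\<bar>
        \<le> (\<Prod>i=0..<N. \<tau> (\<sigma> i) (g i)) / \<rho> ^ (\<Sum>{..<N})" .
    qed
    finally show ?thesis by (simp add: sum_divide_distrib)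
  qed
  have "\<bar>det (mat N N (\<lambda>(i, j). A i j))\<bar> \<le> (\<Sum>g\<in>G. \<bar>D g\<bar>)"
    unfolding det by (rule sum_abs)
  also have "\<dots> \<le> (\<Sum>g\<in>G. (\<Sum>\<sigma>\<in>S. \<Prod>i=0..<N. \<tau> (\<sigma> i) (g i)) / \<rho> ^ (\<Sum>{..<N}))"
    by (rule sum_mono) (rule Dle)
  also have "\<dots> = (\<Sum>\<sigma>\<in>S. \<Sum>g\<in>G. \<Prod>i=0..<N. \<tau> (\<sigma> i) (g i)) / \<rho> ^ (\<Sum>{..<N})"
    unfolding sum_divide_distrib[symmetric] by (rule arg_cong[OF sum.swap])
  \<comment> \<open>The sum over all choices of indices factors back into a product of row sums,
    which \<open>F\<close> bounds.\<close>
  also have "(\<Sum>\<sigma>\<in>S. \<Sum>g\<in>G. \<Prod>i=0..<N. \<tau> (\<sigma> i) (g i)) = (\<Sum>\<sigma>\<in>S. \<Prod>i=0..<N. \<Sum>n\<le>N. \<tau> (\<sigma> i) n)"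
    unfolding G_def by (rule sum.cong[OF refl], rule prod_sum_PiE[symmetric]) auto
  also have "\<dots> \<le> (\<Sum>\<sigma>\<in>S. \<Prod>j<N. F j)"
  proof (rule sum_mono)
    fix \<sigma> assume s: "\<sigma> \<in> S"
    have "(\<Prod>i=0..<N. \<Sum>n\<le>N. \<tau> (\<sigma> i) n) \<le> (\<Prod>i=0..<N. F (\<sigma> i))"
    proof (rule prod_mono, intro conjI)
      fix i assume "i \<in> {0..<N}"
      then have "\<sigma> i < N" by (simp add: less[OF s])
      then show "0 \<le> (\<Sum>n\<le>N. \<tau> (\<sigma> i) n)" "(\<Sum>n\<le>N. \<tau> (\<sigma> i) n) \<le> F (\<sigma> i)"
        by (auto intro: sum_nonneg \<tau>0 \<tau>)
    qed
    also have "\<dots> = (\<Prod>j=0..<N. F j)"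
      using prod.permute[of \<sigma> "{0..<N}" F] s unfolding S_def o_def by (metis mem_Collect_eq)
    finally show "(\<Prod>i=0..<N. \<Sum>n\<le>N. \<tau> (\<sigma> i) n) \<le> (\<Prod>j<N. F j)"
      by (simp add: lessThan_atLeast0)
  qed
  also have "\<dots> = fact N * (\<Prod>j<N. F j)"
    using card_permutations[of "{0..<N}" N] by (simp add: S_def)
  finally show ?thesis using \<rho> by (simp add: divide_right_mono)
qed

section \<open>Majorants of power series\<close>

text \<open>The bound \<open>G\<close> on the absolute values of the Taylor terms at radius
  \<open>x\<close> replaces a maximum over a complex circle, so that the whole argument stays
  real.\<close>

definition majorised :: "(real \<Rightarrow> real) \<Rightarrow> real \<Rightarrow> real \<Rightarrow> bool" where
  "majorised f x G \<longleftrightarrow> (\<exists>a. (\<forall>z. \<bar>z\<bar> \<le> x \<longrightarrow> (\<lambda>n. a n * z ^ n) sums f z)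
     \<and> summable (\<lambda>n. \<bar>a n\<bar> * x ^ n) \<and> (\<Sum>n. \<bar>a n\<bar> * x ^ n) \<le> G)"

lemma majorised_mono: "majorised f x G \<Longrightarrow> G \<le> G' \<Longrightarrow> majorised f x G'"
  unfolding majorised_def by (meson order_trans)

lemma majorised_cmult:
  assumes "majorised f x G"
  shows "majorised (\<lambda>z. k * f z) x (\<bar>k\<bar> * G)"
proof -
  obtain a where a: "\<And>z. \<bar>z\<bar> \<le> x \<Longrightarrow> (\<lambda>n. a n * z ^ n) sums f z"
    "summable (\<lambda>n. \<bar>a n\<bar> * x ^ n)" "(\<Sum>n. \<bar>a n\<bar> * x ^ n) \<le> G"
    using assms by (auto simp: majorised_def)
  show ?thesis
    unfolding majorised_def
  proof (intro exI[of _ "\<lambda>n. k * a n"] conjI allI impI)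
    fix z :: real assume "\<bar>z\<bar> \<le> x"
    from sums_mult[OF a(1)[OF this], of k] show "(\<lambda>n. k * a n * z ^ n) sums (k * f z)"
      by (simp add: mult.assoc)
  next
    show "summable (\<lambda>n. \<bar>k * a n\<bar> * x ^ n)"
      using summable_mult[OF a(2), of "\<bar>k\<bar>"] by (simp add: abs_mult mult.assoc)
    have "(\<Sum>n. \<bar>k * a n\<bar> * x ^ n) = \<bar>k\<bar> * (\<Sum>n. \<bar>a n\<bar> * x ^ n)"
      using suminf_mult[OF a(2), of "\<bar>k\<bar>"] by (simp add: abs_mult mult.assoc)
    then show "(\<Sum>n. \<bar>k * a n\<bar> * x ^ n) \<le> \<bar>k\<bar> * G"
      using a(3) by (simp add: mult_left_mono)
  qed
qed

lemma majorised_linear_mult: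
  assumes "majorised f x G" "x \<ge> 0" "r \<ge> 0"
  shows "majorised (\<lambda>z. (z - r) * f z) x ((x + r) * G)"
proof -
  obtain a where a: "\<And>z. \<bar>z\<bar> \<le> x \<Longrightarrow> (\<lambda>n. a n * z ^ n) sums f z"
    "summable (\<lambda>n. \<bar>a n\<bar> * x ^ n)" "(\<Sum>n. \<bar>a n\<bar> * x ^ n) \<le> G"
    using assms by (auto simp: majorised_def)
  \<comment> \<open>The coefficients of \<open>z * f z\<close>: those of \<open>f\<close> shifted by
    one place.\<close>
  define b where "b n = (case n of 0 \<Rightarrow> 0 | Suc k \<Rightarrow> a k)" for n
  have b: "(\<lambda>n. b n * z ^ n) sums (z * s)" if "(\<lambda>n. a n * z ^ n) sums s" for z s
  proof -
    have "(\<lambda>n. b (Suc n) * z ^ Suc n) sums (z * s)"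
      using sums_mult[OF that, of z] by (simp add: b_def mult_ac)
    then show ?thesis by (subst (asm) sums_Suc_iff) (simp add: b_def)
  qed
  have bb: "(\<lambda>n. \<bar>b n\<bar> * x ^ n) sums (x * (\<Sum>n. \<bar>a n\<bar> * x ^ n))"
  proof -
    have "(\<lambda>n. \<bar>b (Suc n)\<bar> * x ^ Suc n) sums (x * (\<Sum>n. \<bar>a n\<bar> * x ^ n))"
      using sums_mult[OF summable_sums[OF a(2)], of x] by (simp add: b_def mult_ac)
    then show ?thesis by (subst (asm) sums_Suc_iff) (simp add: b_def)
  qed
  define S where "S = (\<Sum>n. \<bar>a n\<bar> * x ^ n)"
  have maj: "(\<lambda>n. \<bar>b n\<bar> * x ^ n + r * (\<bar>a n\<bar> * x ^ n)) sums (x * S + r * S)"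
    unfolding S_def by (intro sums_add bb sums_mult summable_sums a)
  have le: "\<bar>b n - r * a n\<bar> * x ^ n \<le> \<bar>b n\<bar> * x ^ n + r * (\<bar>a n\<bar> * x ^ n)" for n
  proof -
    have "\<bar>b n - r * a n\<bar> \<le> \<bar>b n\<bar> + r * \<bar>a n\<bar>"
      using abs_triangle_ineq4[of "b n" "r * a n"] \<open>r \<ge> 0\<close> by (simp add: abs_mult)
    from mult_right_mono[OF this, of "x ^ n"] show ?thesis
      using \<open>x \<ge> 0\<close> by (simp add: algebra_simps)
  qed
  have sm: "summable (\<lambda>n. \<bar>b n - r * a n\<bar> * x ^ n)"
    by (rule summable_comparison_test'[OF sums_summable[OF maj], of 0])
      (use le \<open>x \<ge> 0\<close> in \<open>simp add: abs_mult\<close>)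
  show ?thesis
    unfolding majorised_def
  proof (intro exI[of _ "\<lambda>n. b n - r * a n"] conjI allI impI sm)
    fix z :: real assume "\<bar>z\<bar> \<le> x"
    note s = a(1)[OF this]
    from sums_diff[OF b[OF s] sums_mult[OF s, of r]]
    show "(\<lambda>n. (b n - r * a n) * z ^ n) sums ((z - r) * f z)"
      by (simp add: algebra_simps)
  next
    have "(\<Sum>n. \<bar>b n - r * a n\<bar> * x ^ n) \<le> x * S + r * S"
      using suminf_le[OF le sm sums_summable[OF maj]] sums_unique[OF maj] by simp
    also have "\<dots> \<le> (x + r) * G"
      using a(3) assms(2,3) mult_left_mono[of S G "x + r"] by (simp add: S_def algebra_simps)
    finally show "(\<Sum>n. \<bar>b n - r * a n\<bar> * x ^ n) \<le> (x + r) * G" .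
  qed
qed

text \<open>Each linear factor \<open>z - i\<close> of the binomial multiplies the majorant by
  \<open>x + i\<close>.\<close>

lemma majorised_gbinomial_mult:
  assumes "majorised f x G" "x \<ge> 0"
  shows "majorised (\<lambda>z. (z gchoose k) * f z) x ((\<Prod>i<k. x + real i) / fact k * G)"
proof (induction k)
  case 0
  then show ?case using assms by simp
next
  case (Suc k)
  have eq: "(z gchoose Suc k) * f z = 1 / real (Suc k) * ((z - real k) * ((z gchoose k) * f z))" for z :: real
    by (simp add: gbinomial_prod_rev field_simps)
  show ?case
    unfolding eq
    by (rule majorised_mono[OF majorised_cmult[OF majorised_linear_mult[OF Suc \<open>x \<ge> 0\<close>]]])
      (auto simp: field_simps)
qed

text \<open>The Taylor coefficients are nonnegative, so the sum of the absolute terms is the value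
  at \<open>x\<close> itself.\<close>

lemma majorised_cosh:
  assumes "c \<ge> 0" "x \<ge> 0"
  shows "majorised (\<lambda>z. cosh (c * z)) x (exp (c * x))"
proof -
  define a where "a n = (if even n then c ^ n / fact n else 0)" for n
  have a: "(\<lambda>n. a n * z ^ n) sums cosh (c * z)" for z
    using cosh_converges[of "c * z"]
    by (rule arg_cong[THEN iffD1, rotated]) (auto simp: a_def fun_eq_iff power_mult_distrib divide_inverse intro!: arg_cong[where f = "\<lambda>f. f sums _"])
  have "\<bar>a n\<bar> = a n" for n using assms by (simp add: a_def)
  then have "(\<lambda>n. \<bar>a n\<bar> * x ^ n) sums cosh (c * x)" using a[of x] by simp
  moreover have "cosh (c * x) \<le> exp (c * x)"
    using assms by (simp add: cosh_def field_simps)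
  ultimately show ?thesis
    unfolding majorised_def using a by (intro exI[of _ a]) (auto simp: sums_iff)
qed

lemma majorised_sinh:
  assumes "c \<ge> 0" "x \<ge> 0"
  shows "majorised (\<lambda>z. sinh (c * z)) x (exp (c * x))"
proof -
  define a where "a n = (if even n then 0 else c ^ n / fact n)" for n
  have a: "(\<lambda>n. a n * z ^ n) sums sinh (c * z)" for z
    using sinh_converges[of "c * z"]
    by (rule arg_cong[THEN iffD1, rotated]) (auto simp: a_def fun_eq_iff power_mult_distrib divide_inverse intro!: arg_cong[where f = "\<lambda>f. f sums _"])
  have "\<bar>a n\<bar> = a n" for n using assms by (simp add: a_def)
  then have "(\<lambda>n. \<bar>a n\<bar> * x ^ n) sums sinh (c * x)" using a[of x] by simp
  moreover have "sinh (c * x) \<le> exp (c * x)"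
    by (simp add: sinh_def field_simps add_increasing)
  ultimately show ?thesis
    unfolding majorised_def using a by (intro exI[of _ a]) (auto simp: sums_iff)
qed

text \<open>The Taylor terms of order below \<open>N\<close> are the rank one parts; index
  \<open>N\<close> collects the Taylor tail and the deviation of \<open>M\<close> from
  \<open>f\<close>. The nodes lie in a disc smaller by the factor \<open>\<rho>\<close>, so a term
  of order n carries \<open>1 / \<rho> ^ n\<close>.\<close>

lemma abs_interpolation_det_le:
  fixes M :: "nat \<Rightarrow> nat \<Rightarrow> real" and f :: "nat \<Rightarrow> real \<Rightarrow> real" and z :: "nat \<Rightarrow> real"
  assumes f: "\<And>j. j < N \<Longrightarrow> majorised (f j) (\<rho> * Z) (G j)"
    and z: "\<And>i. i < N \<Longrightarrow> \<bar>z i\<bar> \<le> Z"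
    and M: "\<And>i j. i < N \<Longrightarrow> j < N \<Longrightarrow> \<bar>M i j - f j (z i)\<bar> \<le> G j / \<rho> ^ N"
    and \<rho>: "\<rho> \<ge> 1" and Z: "Z \<ge> 0"
  shows "\<bar>det (mat N N (\<lambda>(i, j). M i j))\<bar> \<le> fact N * (\<Prod>j<N. 2 * G j) / \<rho> ^ (\<Sum>{..<N})"
proof -
  define x where "x = \<rho> * Z"
  have x: "x \<ge> 0" "Z \<le> x" using \<rho> Z mult_right_mono[of 1 \<rho> Z] by (auto simp: x_def)
  have "\<exists>a. \<forall>j<N. (\<forall>z. \<bar>z\<bar> \<le> x \<longrightarrow> (\<lambda>n. a j n * z ^ n) sums f j z)
     \<and> summable (\<lambda>n. \<bar>a j n\<bar> * x ^ n) \<and> (\<Sum>n. \<bar>a j n\<bar> * x ^ n) \<le> G j"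
    using f unfolding majorised_def x_def[symmetric] by metis
  then obtain a where a: "\<And>j z. j < N \<Longrightarrow> \<bar>z\<bar> \<le> x \<Longrightarrow> (\<lambda>n. a j n * z ^ n) sums f j z"
    "\<And>j. j < N \<Longrightarrow> summable (\<lambda>n. \<bar>a j n\<bar> * x ^ n)"
    "\<And>j. j < N \<Longrightarrow> (\<Sum>n. \<bar>a j n\<bar> * x ^ n) \<le> G j"
    by metis
  define T where "T i j n = (if n < N then z i ^ n * a j n
    else M i j - (\<Sum>n<N. z i ^ n * a j n))" for i j n
  \<comment> \<open>The additional \<open>G j\<close> at \<open>n = N\<close> pays for the deviation
    and causes the factor 2 in the result.\<close>
  define \<tau> where "\<tau> j n = (if n < N then \<bar>a j n\<bar> * x ^ n
    else (\<Sum>n. \<bar>a j n\<bar> * x ^ n) - (\<Sum>n<N. \<bar>a j n\<bar> * x ^ n) + G j)" for j n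
  show ?thesis
  proof (rule abs_det_le_of_expansion[where T = T and b = "\<lambda>i n. z i ^ n" and a = "\<lambda>n j. a j n"
        and \<tau> = \<tau>, OF _ _ _ _ \<rho>])
    fix i j assume ij: "i < N" "j < N"
    have "(\<Sum>n\<le>N. T i j n) = (\<Sum>n<N. T i j n) + T i j N"
      by (simp add: lessThan_Suc_atMost[symmetric])
    then show "M i j = (\<Sum>n\<le>N. T i j n)" by (simp add: T_def)
    fix n
    show "T i j n = z i ^ n * a j n" if "n < N" using that by (simp add: T_def)
    show "\<bar>T i j n\<bar> \<le> \<tau> j n / \<rho> ^ n" if "n \<le> N"
    proof (cases "n < N")
      case True
      have "\<bar>z i\<bar> ^ n * \<bar>a j n\<bar> \<le> Z ^ n * \<bar>a j n\<bar>"
        by (intro mult_right_mono power_mono z ij) auto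
      also have "\<dots> = \<bar>a j n\<bar> * x ^ n / \<rho> ^ n"
        using \<rho> by (simp add: x_def power_mult_distrib)
      finally show ?thesis using True by (simp add: T_def \<tau>_def abs_mult power_abs)
    next
      case False
      then have n: "n = N" using that by simp
      have zx: "\<bar>z i\<bar> \<le> x" using z[OF ij(1)] x by simp
      have tail: "(\<lambda>k. a j (k + N) * z i ^ (k + N)) sums (f j (z i) - (\<Sum>n<N. a j n * z i ^ n))"
        by (subst sums_iff_shift) (use a(1)[OF ij(2) zx] in simp)
      have tail2: "(\<lambda>k. \<bar>a j (k + N)\<bar> * x ^ (k + N)) sums
          ((\<Sum>n. \<bar>a j n\<bar> * x ^ n) - (\<Sum>n<N. \<bar>a j n\<bar> * x ^ n))" (is "_ sums ?S")
        by (subst sums_iff_shift) (use summable_sums[OF a(2)[OF ij(2)]] in simp)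
      have tail3: "(\<lambda>k. \<bar>a j (k + N)\<bar> * x ^ (k + N) / \<rho> ^ N) sums (?S / \<rho> ^ N)"
        by (rule sums_divide[OF tail2])
      have le: "norm (a j (k + N) * z i ^ (k + N)) \<le> \<bar>a j (k + N)\<bar> * x ^ (k + N) / \<rho> ^ N" for k
      proof -
        have "\<bar>z i\<bar> ^ (k + N) * \<rho> ^ N \<le> Z ^ (k + N) * \<rho> ^ (k + N)"
          using \<rho> Z z[OF ij(1)] by (intro mult_mono power_mono power_increasing) auto
        also have "\<dots> = x ^ (k + N)" by (simp add: x_def power_mult_distrib mult.commute)
        finally have "\<bar>z i\<bar> ^ (k + N) \<le> x ^ (k + N) / \<rho> ^ N"
          using \<rho> by (simp add: field_simps)
        from mult_left_mono[OF this, of "\<bar>a j (k + N)\<bar>"] show ?thesis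
          by (simp add: abs_mult power_abs)
      qed
      have "\<bar>f j (z i) - (\<Sum>n<N. a j n * z i ^ n)\<bar> \<le> ?S / \<rho> ^ N"
      proof -
        have sn: "summable (\<lambda>k. norm (a j (k + N) * z i ^ (k + N)))"
          by (rule summable_comparison_test'[OF sums_summable[OF tail3], of 0]) (use le in simp)
        have "norm (\<Sum>k. a j (k + N) * z i ^ (k + N)) \<le> (\<Sum>k. norm (a j (k + N) * z i ^ (k + N)))"
          by (rule summable_norm[OF sn])
        also have "\<dots> \<le> (\<Sum>k. \<bar>a j (k + N)\<bar> * x ^ (k + N) / \<rho> ^ N)"
          by (rule suminf_le[OF le sn sums_summable[OF tail3]])
        finally show ?thesis using sums_unique[OF tail] sums_unique[OF tail3] by simp
      qed
      moreover have "\<bar>M i j - f j (z i)\<bar> \<le> G j / \<rho> ^ N" by (rule M[OF ij])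
      ultimately have "\<bar>M i j - (\<Sum>n<N. a j n * z i ^ n)\<bar> \<le> ?S / \<rho> ^ N + G j / \<rho> ^ N"
        by linarith
      then show ?thesis by (simp add: T_def \<tau>_def n add_divide_distrib mult.commute)
    qed
  next
    fix j assume j: "j < N"
    have "(\<Sum>n\<le>N. \<tau> j n) = (\<Sum>n<N. \<tau> j n) + \<tau> j N"
      by (simp add: lessThan_Suc_atMost[symmetric])
    also have "\<dots> = (\<Sum>n. \<bar>a j n\<bar> * x ^ n) + G j" by (simp add: \<tau>_def)
    finally show "(\<Sum>n\<le>N. \<tau> j n) \<le> 2 * G j" using a(3)[OF j] by simp
  qed
qed

section \<open>A zero estimate\<close>

text \<open>A vanishing determinant gives, through the kernel of the transpose, a nonzero polynomial
  of degree below \<open>m\<close> with the \<open>m\<close> distinct roots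
  \<open>\<gamma> ^ e j\<close>.\<close>

lemma det_geometric_ne_0:
  fixes \<gamma> :: real and e :: "nat \<Rightarrow> nat" and c :: "nat \<Rightarrow> real"
  assumes \<gamma>: "\<gamma> > 0" "\<gamma> \<noteq> 1" and e: "inj_on e {..<m}" and c: "\<And>j. j < m \<Longrightarrow> c j \<noteq> 0"
  shows "det (mat m m (\<lambda>(i, j). \<gamma> ^ (i * e j) * c j)) \<noteq> 0"
proof
  let ?A = "mat m m (\<lambda>(i, j). \<gamma> ^ (i * e j) * c j)"
  assume "det ?A = 0"
  then have "det (transpose_mat ?A) = 0" using det_transpose[of ?A m] by simp
  then obtain v where v: "v \<in> carrier_vec m" "v \<noteq> 0\<^sub>v m" "transpose_mat ?A *\<^sub>v v = 0\<^sub>v m"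
    by (subst (asm) det_0_iff_vec_prod_zero[of _ m]) auto
  define p where "p = (\<Sum>i<m. monom (v $ i) i)"
  have cp: "coeff p i = (if i < m then v $ i else 0)" for i
    by (auto simp: p_def coeff_sum if_distrib cong: if_cong)
  obtain i0 where i0: "i0 < m" "v $ i0 \<noteq> 0"
    using v(1,2) by (auto simp: vec_eq_iff)
  then have p0: "p \<noteq> 0" using cp[of i0] by auto
  have "degree p < m"
  proof -
    have "degree p \<le> m - 1" by (rule degree_le) (use i0 in \<open>auto simp: cp\<close>)
    then show ?thesis using i0 by simp
  qed
  moreover have "poly p (\<gamma> ^ e j) = 0" if j: "j < m" for j
  proof -
    have "0 = (transpose_mat ?A *\<^sub>v v) $ j" using v(3) j by simp
    also have "\<dots> = (\<Sum>i<m. \<gamma> ^ (i * e j) * c j * v $ i)"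
      using j v(1) by (simp add: mult_mat_vec_def scalar_prod_def lessThan_atLeast0)
    also have "\<dots> = c j * poly p (\<gamma> ^ e j)"
      by (simp add: p_def poly_sum poly_monom sum_distrib_left mult_ac power_mult[symmetric])
    finally show ?thesis using c[OF j] by simp
  qed
  moreover have "inj_on (\<lambda>j. \<gamma> ^ e j) {..<m}"
  proof (rule inj_onI)
    fix j j' assume jj: "j \<in> {..<m}" "j' \<in> {..<m}" and eq: "\<gamma> ^ e j = \<gamma> ^ e j'"
    have "e j * ln \<gamma> = e j' * ln \<gamma>"
      using arg_cong[OF eq, of ln] \<gamma> by (simp add: ln_realpow)
    moreover have "ln \<gamma> \<noteq> 0" using \<gamma> by simp
    ultimately have "e j = e j'" by simp
    then show "j = j'" using e jj by (auto dest: inj_onD)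
  qed
  then have "card ((\<lambda>j. \<gamma> ^ e j) ` {..<m}) = m" by (simp add: card_image)
  moreover have "card ((\<lambda>j. \<gamma> ^ e j) ` {..<m}) \<le> card {x. poly p x = 0}"
    by (rule card_mono) (use p0 calculation(2) in \<open>auto simp: poly_roots_finite\<close>)
  moreover have "card {x. poly p x = 0} \<le> degree p"
    by (rule card_poly_roots_bound[OF p0])
  ultimately show False by linarith
qed

text \<open>Zero estimate: with \<open>B i j\<close> the coefficient of \<open>w ^ e j\<close> in the \<open>i\<close>-th translate, the vector
  of the \<open>w ^ e j\<close> lies in the kernel of \<open>B\<close> at every zero, so \<open>det B\<close>, a polynomial in \<open>z\<close> alone,
  vanishes there; its top coefficient is a Vandermonde determinant in powers of \<open>\<gamma>\<close>.\<close>

lemma card_common_zeros_of_translates_le: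
  fixes q :: "nat \<Rightarrow> real poly" and \<gamma> s :: real and P :: "(real \<times> real) set"
  assumes deg: "\<And>l. l < L \<Longrightarrow> degree (q l) \<le> d"
    and nz: "\<exists>l<L. q l \<noteq> 0"
    and \<gamma>: "\<gamma> > 0" "\<gamma> \<noteq> 1"
    and van: "\<And>z w t. (z, w) \<in> P \<Longrightarrow> t < L \<Longrightarrow>
      (\<Sum>l<L. poly (q l) (z + real t * s) * (\<gamma> ^ t * w) ^ l) = 0"
    and w: "\<And>z w. (z, w) \<in> P \<Longrightarrow> w \<noteq> 0"
  shows "card (fst ` P) \<le> d * L"
proof -
  \<comment> \<open>Only the nonzero \<open>q l\<close> enter, so that every column of the matrix
    has a nonzero leading coefficient.\<close>
  define I where "I = {l. l < L \<and> q l \<noteq> 0}"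
  define m where "m = card I"
  have finI: "finite I" by (simp add: I_def)
  obtain e where e: "bij_betw e {..<m} I"
    using ex_bij_betw_nat_finite[OF finI] by (auto simp: m_def lessThan_atLeast0)
  have eI: "e j < L" "q (e j) \<noteq> 0" if "j < m" for j
    using e that by (auto simp: bij_betw_def I_def)
  have mL: "m \<le> L"
    using card_mono[of "{..<L}" I] by (auto simp: m_def I_def)
  have m0: "m > 0" using nz finI by (auto simp: m_def card_gt_0_iff I_def)
  define B where "B i j = smult (\<gamma> ^ (i * e j)) (pcompose (q (e j)) [:real i * s, 1:])" for i j
  define M where "M = mat m m (\<lambda>(i, j). B i j)"
  have degB: "degree (B i j) = degree (q (e j))" for i j
    using \<gamma> by (simp add: B_def degree_pcompose)
  have lcB: "lead_coeff (B i j) = \<gamma> ^ (i * e j) * lead_coeff (q (e j))" for i j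
    using \<gamma> lead_coeff_comp[of "[:real i * s, 1:]" "q (e j)"] by (simp add: B_def)
  have Mc: "M \<in> carrier_mat m m" by (simp add: M_def)
  have "degree (det M) \<le> d * m"
    by (rule degree_det_le[OF _ Mc]) (auto simp: M_def degB deg eI)
  also have "\<dots> \<le> d * L" using mL by simp
  finally have degD: "degree (det M) \<le> d * L" .
  \<comment> \<open>Translation preserves degrees, so the entries of a column share one degree and
    every Leibniz term has degree exactly \<open>E\<close>. The coefficient at \<open>E\<close> is
    therefore the determinant of the leading coefficients.\<close>
  define E where "E = (\<Sum>j=0..<m. degree (q (e j)))"
  have "coeff (det M) E = det (mat m m (\<lambda>(i, j). \<gamma> ^ (i * e j) * lead_coeff (q (e j))))"
  proof -
    have leib: "coeff (signof \<sigma> * (\<Prod>i=0..<m. M $$ (i, \<sigma> i))) E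
        = signof \<sigma> * (\<Prod>i=0..<m. \<gamma> ^ (i * e (\<sigma> i)) * lead_coeff (q (e (\<sigma> i))))"
      if s: "\<sigma> permutes {0..<m}" for \<sigma>
    proof -
      have less: "\<sigma> i < m" if "i < m" for i
        using permutes_in_image[OF s, of i] that by simp
      have M: "(\<Prod>i=0..<m. M $$ (i, \<sigma> i)) = (\<Prod>i=0..<m. B i (\<sigma> i))"
        by (rule prod.cong) (auto simp: M_def less)
      have Bnz: "B i (\<sigma> i) \<noteq> 0" if "i < m" for i
        using lcB[of i "\<sigma> i"] eI(2)[OF less[OF that]] \<gamma> by auto
      have "degree (\<Prod>i=0..<m. B i (\<sigma> i)) = (\<Sum>i=0..<m. degree (q (e (\<sigma> i))))"
        by (subst degree_prod_eq_sum_degree) (auto simp: Bnz degB)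
      also have "\<dots> = E"
        using sum.permute[OF s, of "\<lambda>j. degree (q (e j))"] unfolding E_def o_def by simp
      finally have "coeff (\<Prod>i=0..<m. B i (\<sigma> i)) E = (\<Prod>i=0..<m. lead_coeff (B i (\<sigma> i)))"
        using lead_coeff_prod[of "\<lambda>i. B i (\<sigma> i)" "{0..<m}"] by simp
      then show ?thesis unfolding M lcB by (simp add: sign_def)
    qed
    show ?thesis
      unfolding det_def'[OF Mc] coeff_sum
      by (subst det_def'[of _ m]) (auto simp: leib permutes_in_image intro!: sum.cong prod.cong)
  qed
  also have "\<dots> \<noteq> 0"
    by (rule det_geometric_ne_0[OF \<gamma>]) (use e eI in \<open>auto simp: bij_betw_def\<close>)
  finally have D0: "det M \<noteq> 0" by auto
  have root: "poly (det M) z = 0" if zw: "(z, w) \<in> P" for z w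
  proof -
    interpret ev: comm_ring_hom "\<lambda>p. poly p z" by unfold_locales auto
    have "poly (det M) z = det (map_mat (\<lambda>p. poly p z) M)" by simp
    also have "\<dots> = 0"
    proof (subst det_0_iff_vec_prod_zero[of _ m])
      show "map_mat (\<lambda>p. poly p z) M \<in> carrier_mat m m" using Mc by simp
      define v where "v = vec m (\<lambda>j. w ^ e j)"
      have "v $ 0 \<noteq> 0" using m0 w[OF zw] by (simp add: v_def)
      then have "v \<noteq> 0\<^sub>v m" using m0 by auto
      moreover have "map_mat (\<lambda>p. poly p z) M *\<^sub>v v = 0\<^sub>v m"
      proof (rule eq_vecI)
        fix i assume "i < dim_vec (0\<^sub>v m :: real vec)"
        then have i: "i < m" by simp
        have "(map_mat (\<lambda>p. poly p z) M *\<^sub>v v) $ i = (\<Sum>j<m. poly (B i j) z * w ^ e j)"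
          using i by (simp add: M_def v_def mult_mat_vec_def scalar_prod_def lessThan_atLeast0)
        also have "\<dots> = (\<Sum>j<m. poly (q (e j)) (z + real i * s) * (\<gamma> ^ i * w) ^ e j)"
          by (rule sum.cong) (auto simp: B_def poly_pcompose power_mult_distrib power_mult algebra_simps)
        also have "\<dots> = (\<Sum>l\<in>I. poly (q l) (z + real i * s) * (\<gamma> ^ i * w) ^ l)"
          using sum.reindex_bij_betw[OF e] by simp
        also have "\<dots> = (\<Sum>l<L. poly (q l) (z + real i * s) * (\<gamma> ^ i * w) ^ l)"
          by (rule sum.mono_neutral_left) (auto simp: I_def)
        also have "\<dots> = 0" using van[OF zw, of i] i mL by simp
        finally show "(map_mat (\<lambda>p. poly p z) M *\<^sub>v v) $ i = 0\<^sub>v m $ i" using i by simp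
      qed (simp add: M_def)
      ultimately show "\<exists>v. v \<in> carrier_vec m \<and> v \<noteq> 0\<^sub>v m \<and> map_mat (\<lambda>p. poly p z) M *\<^sub>v v = 0\<^sub>v m"
        by (intro exI[of _ v]) (simp add: v_def)
    qed
    finally show ?thesis .
  qed
  have "card (fst ` P) \<le> card {z. poly (det M) z = 0}"
    by (rule card_mono) (use D0 root in \<open>auto simp: poly_roots_finite\<close>)
  also have "\<dots> \<le> degree (det M)" by (rule card_poly_roots_bound[OF D0])
  finally show ?thesis using degD by simp
qed

section \<open>The interpolation matrix of the linear form\<close>

text \<open>Every Leibniz term uses each column exactly once, so one denominator per column
  suffices.\<close>

lemma det_column_scaled_Ints:
  fixes A :: "nat \<Rightarrow> nat \<Rightarrow> real"
  assumes "\<And>i j. i < N \<Longrightarrow> j < N \<Longrightarrow> c j * A i j \<in> \<int>"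
  shows "(\<Prod>j<N. c j) * det (mat N N (\<lambda>(i, j). A i j)) \<in> \<int>"
proof -
  have "(\<Prod>j<N. c j) * det (mat N N (\<lambda>(i, j). A i j))
      = (\<Sum>\<sigma> | \<sigma> permutes {0..<N}. (\<Prod>j<N. c j) * (signof \<sigma> * (\<Prod>i=0..<N. A i (\<sigma> i))))"
    by (subst det_def'[of _ N])
      (auto simp: sum_distrib_left permutes_in_image intro!: sum.cong prod.cong)
  also have "\<dots> = (\<Sum>\<sigma> | \<sigma> permutes {0..<N}. signof \<sigma> * (\<Prod>i=0..<N. c (\<sigma> i) * A i (\<sigma> i)))"
  proof (rule sum.cong[OF refl])
    fix \<sigma> assume "\<sigma> \<in> {\<sigma>. \<sigma> permutes {0..<N}}"
    then have "(\<Prod>j<N. c j) = (\<Prod>i=0..<N. c (\<sigma> i))"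
      using prod.permute[of \<sigma> "{0..<N}" c] by (simp add: lessThan_atLeast0 o_def)
    then show "(\<Prod>j<N. c j) * (signof \<sigma> * (\<Prod>i=0..<N. A i (\<sigma> i)))
        = signof \<sigma> * (\<Prod>i=0..<N. c (\<sigma> i) * A i (\<sigma> i))"
      by (simp add: prod.distrib)
  qed
  also have "\<dots> \<in> \<int>"
  proof (rule Ints_sum)
    fix \<sigma> assume s: "\<sigma> \<in> {\<sigma>. \<sigma> permutes {0..<N}}"
    have "(\<Prod>i=0..<N. c (\<sigma> i) * A i (\<sigma> i)) \<in> \<int>"
    proof (rule Ints_prod)
      fix i assume "i \<in> {0..<N}"
      then show "c (\<sigma> i) * A i (\<sigma> i) \<in> \<int>"
        using s assms[of i "\<sigma> i"] permutes_in_image[of \<sigma> "{0..<N}" i] by simp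
    qed
    then show "signof \<sigma> * (\<Prod>i=0..<N. c (\<sigma> i) * A i (\<sigma> i)) \<in> \<int>" by (simp add: sign_def)
  qed
  finally show ?thesis .
qed

section \<open>Indexing of the columns, binomial polynomials and hyperbolic functions\<close>

text \<open>Columns are numbered m = 5 k + l, where k is the degree of the binomial and l the index
  of the hyperbolic function.\<close>

lemma sum_div_mod_5:
  "(\<Sum>m<5 * K. f (m div 5) (m mod 5)) = (\<Sum>k<K. \<Sum>l<5::nat. f k l :: 'a :: comm_monoid_add)"
proof (induction K)
  case (Suc K)
  have "{..<5 * Suc K} = {..<5 * K} \<union> (\<lambda>l. 5 * K + l) ` {..<5}"
  proof (intro equalityI subsetI)
    fix m assume "m \<in> {..<5 * Suc K}"
    then show "m \<in> {..<5 * K} \<union> (\<lambda>l. 5 * K + l) ` {..<5}"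
      by (cases "m < 5 * K") (auto intro!: image_eqI[of _ _ "m - 5 * K"])
  qed auto
  then have "(\<Sum>m<5 * Suc K. f (m div 5) (m mod 5)) = (\<Sum>m<5 * K. f (m div 5) (m mod 5))
      + (\<Sum>m\<in>(\<lambda>l. 5 * K + l) ` {..<5}. f (m div 5) (m mod 5))"
    by (subst sum.union_disjoint[symmetric]) auto
  also have "(\<Sum>m\<in>(\<lambda>l. 5 * K + l) ` {..<5}. f (m div 5) (m mod 5)) = (\<Sum>l<5. f K l)"
    by (subst sum.reindex) (auto intro!: sum.cong simp: o_def)
  finally show ?case by (simp add: Suc)
qed simp

text \<open>Binomials are preferred to monomials because they are integers at integer arguments and
  yet carry the saving \<open>1 / fact k\<close>.\<close>

definition binomial_poly :: "nat \<Rightarrow> real poly" where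
  "binomial_poly k = smult (1 / fact k) (\<Prod>i<k. [:- real i, 1:])"

lemma poly_binomial_poly: "poly (binomial_poly k) z = z gchoose k"
  by (simp add: binomial_poly_def gbinomial_prod_rev poly_prod lessThan_atLeast0)

lemma degree_binomial_poly_le: "degree (binomial_poly k) \<le> k"
proof -
  have "degree (\<Prod>i<k. [:- real i, 1:]) \<le> (\<Sum>i<k. degree [:- real i, 1:])"
    using degree_prod_sum_le[of "{..<k}" "\<lambda>i. [:- real i, 1:]"] by (simp add: o_def)
  then show ?thesis by (simp add: binomial_poly_def)
qed

text \<open>Evaluation at 0, 1, 2, ... yields a triangular system with ones on the diagonal.\<close>

lemma binomial_poly_independent:
  assumes "(\<Sum>k<K. smult (c k) (binomial_poly k)) = 0" "n < K"
  shows "c n = 0"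
  using assms(2)
proof (induction n rule: less_induct)
  case (less n)
  have "0 = poly (\<Sum>k<K. smult (c k) (binomial_poly k)) (real n)" using assms(1) by simp
  also have "\<dots> = (\<Sum>k<K. c k * real (n choose k))"
    by (simp add: poly_sum poly_binomial_poly binomial_gbinomial)
  also have "\<dots> = (\<Sum>k\<in>{n}. c k * real (n choose k))"
    using less by (intro sum.mono_neutral_right) (auto simp: not_less neq_iff)
  finally show ?case by simp
qed

text \<open>The functions \<open>exp (l t)\<close>, \<open>\<bar>l\<bar> \<le> 2\<close>, are replaced by the basis \<open>1\<close>, \<open>cosh t\<close>,
  \<open>cosh (2 t)\<close>, \<open>sinh t / \<surd>2\<close>, \<open>sinh (2 t) / \<surd>2\<close> of the same space because its values are
  rational at the interpolation points.\<close>

definition hyp_basis :: "nat \<Rightarrow> real \<Rightarrow> real" where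
  "hyp_basis l t = (if l < 3 then cosh (real l * t) else sinh (real (l - 2) * t) / sqrt 2)"

text \<open>The frequencies 0, 1, 2, 1, 2 of the five functions; they govern the growth as well as
  the power of \<open>y\<close> in the denominator.\<close>

definition hyp_freq :: "nat \<Rightarrow> nat" where
  "hyp_freq l = (if l < 3 then l else l - 2)"

lemma hyp_freq_le: "l < 5 \<Longrightarrow> hyp_freq l \<le> 2"
  by (auto simp: hyp_freq_def)

text \<open>Multiplication by \<open>exp t ^ 2\<close> produces a polynomial of degree at most 4 in
  \<open>exp t\<close>, the shape that the zero estimate requires.\<close>

lemma hyp_basis_combination:
  "exp t ^ 2 * (\<Sum>l<5. c l * hyp_basis l t) = (\<Sum>l<5. (
     if l = 0 then c 2 / 2 - c 4 / (2 * sqrt 2) else if l = 1 then c 1 / 2 - c 3 / (2 * sqrt 2)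
     else if l = 2 then c 0 else if l = 3 then c 1 / 2 + c 3 / (2 * sqrt 2)
     else c 2 / 2 + c 4 / (2 * sqrt 2)) * exp t ^ l)"
proof -
  define w where "w = exp t"
  have w: "w \<noteq> 0" by (simp add: w_def)
  have e: "exp (- t) = 1 / w" "exp (2 * t) = w ^ 2" "exp (- (2 * t)) = 1 / w ^ 2"
    by (simp_all add: w_def exp_minus divide_inverse exp_double[symmetric])
  have h: "w ^ 2 * cosh t = (w ^ 3 + w) / 2" "w ^ 2 * cosh (2 * t) = (w ^ 4 + 1) / 2"
    "w ^ 2 * sinh t = (w ^ 3 - w) / 2" "w ^ 2 * sinh (2 * t) = (w ^ 4 - 1) / 2"
    using w by (simp_all add: cosh_def sinh_def e flip: w_def)
      (simp_all add: field_simps power2_eq_square power3_eq_cube power4_eq_xxxx)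
  have five: "{..<5::nat} = {0, 1, 2, 3, 4}" by auto
  have "w ^ 2 * (\<Sum>l<5. c l * hyp_basis l t) = c 0 * w ^ 2 + c 1 * (w ^ 2 * cosh t)
      + c 2 * (w ^ 2 * cosh (2 * t)) + c 3 / sqrt 2 * (w ^ 2 * sinh t)
      + c 4 / sqrt 2 * (w ^ 2 * sinh (2 * t))"
    unfolding five by (simp add: hyp_basis_def algebra_simps)
  then show ?thesis
    unfolding h w_def[symmetric] unfolding five by (simp add: algebra_simps add_divide_distrib diff_divide_distrib)
qed

section \<open>Perturbation and growth of the hyperbolic functions\<close>

text \<open>Addition formula, with \<open>cosh\<close> and \<open>sinh\<close> of |A| at most
  \<open>exp \<bar>A\<bar>\<close>, and \<open>cosh \<bar>h\<bar> - 1 + sinh \<bar>h\<bar> = exp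
  \<bar>h\<bar> - 1\<close>.\<close>

lemma abs_cosh_add_diff_le: "\<bar>cosh (A + h) - cosh A\<bar> \<le> exp \<bar>A\<bar> * (exp \<bar>h\<bar> - 1)" for A h :: real
proof -
  have "cosh (A + h) - cosh A = cosh A * (cosh h - 1) + sinh A * sinh h"
    by (simp add: cosh_add algebra_simps)
  then have "\<bar>cosh (A + h) - cosh A\<bar> \<le> \<bar>cosh A * (cosh h - 1)\<bar> + \<bar>sinh A * sinh h\<bar>" by linarith
  also have "\<dots> = cosh \<bar>A\<bar> * (cosh \<bar>h\<bar> - 1) + sinh \<bar>A\<bar> * sinh \<bar>h\<bar>"
    using cosh_real_ge_1[of h] by (simp add: abs_mult abs_of_nonneg)
  also have "\<dots> \<le> exp \<bar>A\<bar> * (cosh \<bar>h\<bar> - 1) + exp \<bar>A\<bar> * sinh \<bar>h\<bar>"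
  proof -
    have "0 \<le> sinh \<bar>A\<bar>" "0 \<le> sinh \<bar>h\<bar>" by simp_all
    moreover have "cosh \<bar>A\<bar> \<ge> 1" "cosh \<bar>h\<bar> \<ge> 1" by (rule cosh_real_ge_1)+
    ultimately show ?thesis
      using cosh_plus_sinh[of "\<bar>A\<bar>"] by (intro add_mono mult_right_mono) linarith+
  qed
  also have "\<dots> = exp \<bar>A\<bar> * (exp \<bar>h\<bar> - 1)"
    by (simp add: cosh_plus_sinh[symmetric] algebra_simps)
  finally show ?thesis .
qed

lemma abs_sinh_add_diff_le: "\<bar>sinh (A + h) - sinh A\<bar> \<le> exp \<bar>A\<bar> * (exp \<bar>h\<bar> - 1)" for A h :: real
proof -
  have "sinh (A + h) - sinh A = sinh A * (cosh h - 1) + cosh A * sinh h"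
    by (simp add: sinh_add algebra_simps)
  then have "\<bar>sinh (A + h) - sinh A\<bar> \<le> \<bar>sinh A * (cosh h - 1)\<bar> + \<bar>cosh A * sinh h\<bar>" by linarith
  also have "\<dots> = sinh \<bar>A\<bar> * (cosh \<bar>h\<bar> - 1) + cosh \<bar>A\<bar> * sinh \<bar>h\<bar>"
    using cosh_real_ge_1[of h] by (simp add: abs_mult abs_of_nonneg)
  also have "\<dots> \<le> exp \<bar>A\<bar> * (cosh \<bar>h\<bar> - 1) + exp \<bar>A\<bar> * sinh \<bar>h\<bar>"
  proof -
    have "0 \<le> sinh \<bar>A\<bar>" "0 \<le> sinh \<bar>h\<bar>" by simp_all
    moreover have "cosh \<bar>A\<bar> \<ge> 1" "cosh \<bar>h\<bar> \<ge> 1" by (rule cosh_real_ge_1)+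
    ultimately show ?thesis
      using cosh_plus_sinh[of "\<bar>A\<bar>"] by (intro add_mono mult_right_mono) linarith+
  qed
  also have "\<dots> = exp \<bar>A\<bar> * (exp \<bar>h\<bar> - 1)"
    by (simp add: cosh_plus_sinh[symmetric] algebra_simps)
  finally show ?thesis .
qed

text \<open>The cost of replacing the exponent of a point by the nearby multiple of its abscissa.
  The divisor sqrt 2 only helps.\<close>

lemma abs_hyp_basis_add_diff_le:
  "\<bar>hyp_basis l (A + h) - hyp_basis l A\<bar>
    \<le> exp (real (hyp_freq l) * \<bar>A\<bar>) * (exp (real (hyp_freq l) * \<bar>h\<bar>) - 1)"
proof (cases "l < 3")
  case True
  then show ?thesis
    using abs_cosh_add_diff_le[of "real l * A" "real l * h"]
    by (simp add: hyp_basis_def hyp_freq_def distrib_left abs_mult)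
next
  case False
  have "\<bar>hyp_basis l (A + h) - hyp_basis l A\<bar>
      = \<bar>sinh (real (l - 2) * A + real (l - 2) * h) - sinh (real (l - 2) * A)\<bar> / sqrt 2"
    using False by (simp add: hyp_basis_def distrib_left diff_divide_distrib[symmetric])
  also have "\<dots> \<le> \<bar>sinh (real (l - 2) * A + real (l - 2) * h) - sinh (real (l - 2) * A)\<bar> / 1"
    by (intro divide_left_mono) auto
  also have "\<dots> \<le> exp \<bar>real (l - 2) * A\<bar> * (exp \<bar>real (l - 2) * h\<bar> - 1)"
    using abs_sinh_add_diff_le by simp
  finally show ?thesis using False by (simp add: hyp_freq_def abs_mult)
qed

lemma majorised_hyp_basis:
  assumes "c \<ge> 0" "x \<ge> 0"
  shows "majorised (\<lambda>z. hyp_basis l (c * z)) x (exp (real (hyp_freq l) * c * x))"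
proof (cases "l < 3")
  case True
  then show ?thesis
    using majorised_cosh[of "real l * c" x] assms
    by (simp add: hyp_basis_def hyp_freq_def mult.assoc)
next
  case False
  have "majorised (\<lambda>z. 1 / sqrt 2 * sinh (real (l - 2) * c * z)) x
      (\<bar>1 / sqrt 2\<bar> * exp (real (l - 2) * c * x))"
    by (rule majorised_cmult[OF majorised_sinh]) (use assms in auto)
  then have "majorised (\<lambda>z. 1 / sqrt 2 * sinh (real (l - 2) * c * z)) x
      (exp (real (l - 2) * c * x))"
    by (rule majorised_mono) (simp add: field_simps)
  then show ?thesis using False by (simp add: hyp_basis_def hyp_freq_def mult.assoc)
qed

lemma abs_gbinomial_le:
  fixes z x :: real
  assumes "\<bar>z\<bar> \<le> x"
  shows "\<bar>z gchoose k\<bar> \<le> (\<Prod>i<k. x + real i) / fact k"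
proof -
  have "\<bar>\<Prod>i<k. z - real i\<bar> \<le> (\<Prod>i<k. x + real i)"
    unfolding abs_prod by (rule prod_mono) (use assms in auto)
  then show ?thesis
    by (simp add: gbinomial_prod_rev lessThan_atLeast0 divide_right_mono)
qed

section \<open>Rationality and denominators at the interpolation points\<close>

text \<open>The images of one element of Z[sqrt 2] under the two real embeddings.\<close>

definition conj_pair :: "real \<Rightarrow> real \<Rightarrow> bool" where
  "conj_pair s t \<longleftrightarrow> (\<exists>A B. s = of_int A + of_int B * sqrt 2 \<and> t = of_int A - of_int B * sqrt 2)"

lemma conj_pairI: "s = of_int A + of_int B * sqrt 2 \<Longrightarrow> t = of_int A - of_int B * sqrt 2 \<Longrightarrow> conj_pair s t"
  unfolding conj_pair_def by blast

lemma conj_pair_sym: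
  assumes "conj_pair s t"
  shows "conj_pair t s"
proof -
  obtain A B :: int where "s = A + B * sqrt 2" "t = A - B * sqrt 2"
    using assms by (auto simp: conj_pair_def)
  then show ?thesis by (intro conj_pairI[of _ A "- B"]) simp_all
qed

lemma conj_pair_mult:
  assumes "conj_pair s t" "conj_pair s' t'"
  shows "conj_pair (s * s') (t * t')"
proof -
  obtain A B A' B' :: int where e: "s = A + B * sqrt 2" "t = A - B * sqrt 2"
    "s' = A' + B' * sqrt 2" "t' = A' - B' * sqrt 2"
    using assms by (auto simp: conj_pair_def)
  show ?thesis
    unfolding e by (rule conj_pairI[of _ "A * A' + 2 * B * B'" "A * B' + B * A'"])
      (simp_all add: algebra_simps)
qed

lemma conj_pair_of_int: "conj_pair (of_int k) (of_int k)"
  by (rule conj_pairI[of _ k 0]) simp_all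

lemma conj_pair_power: "conj_pair s t \<Longrightarrow> conj_pair (s ^ n) (t ^ n)"
proof (induction n)
  case 0
  then show ?case using conj_pair_of_int[of 1] by simp
qed (simp add: conj_pair_mult)

lemma conj_pair_exp_nat:
  assumes "conj_pair (k * exp t) (k * exp (- t))"
  shows "conj_pair (k ^ n * exp (real n * t)) (k ^ n * exp (- (real n * t)))"
  using conj_pair_power[OF assms, of n]
  by (simp add: power_mult_distrib exp_of_nat_mult[symmetric])

text \<open>Conjugation exchanges \<open>k * exp t\<close> and \<open>k * exp (- t)\<close>, so a
  negative \<open>j\<close> also costs only \<open>\<bar>j\<bar>\<close> factors
  \<open>k\<close>.\<close>

lemma conj_pair_exp_int:
  assumes "conj_pair (k * exp t) (k * exp (- t))"
  shows "conj_pair (k ^ nat \<bar>j\<bar> * exp (of_int j * t)) (k ^ nat \<bar>j\<bar> * exp (- (of_int j * t)))"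
proof (cases "j \<ge> 0")
  case True
  then show ?thesis using conj_pair_exp_nat[OF assms, of "nat j"] by simp
next
  case False
  then show ?thesis using conj_pair_sym[OF conj_pair_exp_nat[OF assms, of "nat (- j)"]] by simp
qed

text \<open>If the scaled exponentials are A + B sqrt 2 and A - B sqrt 2, then scaled
  \<open>cosh\<close> is their half sum A, and scaled \<open>sinh\<close> divided by sqrt 2 is
  B.\<close>

lemma hyp_basis_Ints:
  assumes "conj_pair (k * exp t) (k * exp (- t))"
  shows "k ^ hyp_freq l * hyp_basis l t \<in> \<int>"
proof -
  define e where "e = hyp_freq l"
  obtain A B :: int where AB: "k ^ e * exp (real e * t) = A + B * sqrt 2"
    "k ^ e * exp (- (real e * t)) = A - B * sqrt 2"
    using conj_pair_exp_nat[OF assms, of e] by (auto simp: conj_pair_def)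
  have "k ^ e * cosh (real e * t) = (k ^ e * exp (real e * t) + k ^ e * exp (- (real e * t))) / 2"
    "k ^ e * sinh (real e * t) = (k ^ e * exp (real e * t) - k ^ e * exp (- (real e * t))) / 2"
    by (simp_all add: cosh_def sinh_def algebra_simps)
  then have "k ^ e * cosh (real e * t) = A" "k ^ e * (sinh (real e * t) / sqrt 2) = B"
    unfolding AB by simp_all
  moreover have "k ^ e * hyp_basis l t = k ^ e * cosh (real e * t)
      \<or> k ^ e * hyp_basis l t = k ^ e * (sinh (real e * t) / sqrt 2)"
    by (simp add: hyp_basis_def e_def hyp_freq_def)
  ultimately show ?thesis unfolding e_def[symmetric] by (metis Ints_of_int)
qed

text \<open>A negative upper argument reflects, up to sign, to an ordinary binomial
  coefficient.\<close>

lemma gbinomial_of_int_in_Ints: "(of_int m :: real) gchoose k \<in> \<int>"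
proof (cases "m \<ge> 0")
  case True
  then have "(of_int m :: real) gchoose k = of_nat (nat m choose k)"
    by (simp add: binomial_gbinomial)
  then show ?thesis by simp
next
  case False
  show ?thesis
  proof (cases k)
    case (Suc k')
    have "real (nat (- m) + k') = - real_of_int m + real k - 1" using False Suc by simp
    then have "(of_int m :: real) gchoose k = (- 1) ^ k * of_nat (nat (- m) + k' choose k)"
      using gbinomial_minus[of "- real_of_int m" k] by (simp add: binomial_gbinomial)
    then show ?thesis by simp
  qed simp
qed

section \<open>The linear form and its interpolation matrix\<close>

text \<open>What the determinant argument uses of a solution: \<open>exp u\<close> is the square of
  1 + sqrt 2, and \<open>exp v\<close> is the absolute quotient of a + b sqrt 2 by its conjugate,
  their product being \<open>y\<close> up to sign.\<close>

locale linear_form =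
  fixes p :: nat and r y a b :: int and u v :: real
  assumes p_pos: "p > 0" and coprime_r_p: "coprime r (int p)" and r_le: "2 * \<bar>r\<bar> \<le> int p"
    and y_gt_1: "y > 1"
    and exp_u: "exp u = 3 + 2 * sqrt 2"
    and exp_v: "y * exp v = (a + b * sqrt 2)\<^sup>2" and exp_minus_v: "y * exp (- v) = (a - b * sqrt 2)\<^sup>2"
    and v_ne_0: "v \<noteq> 0"
begin

definition form :: real where "form = of_int r * u + of_nat p * v"

definition abscissa :: "int \<times> int \<Rightarrow> real" where
  "abscissa x = of_int (int p * snd x - r * fst x)"

definition exponent :: "int \<times> int \<Rightarrow> real" where
  "exponent x = of_int (snd x) * u + of_int (fst x) * v"

lemma u_nonneg: "u \<ge> 0"
proof -
  have "exp u \<ge> 1" unfolding exp_u by (simp add: add_increasing2)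
  then show ?thesis by simp
qed

text \<open>The exact form of the near dependence of the exponent on the abscissa; the error is a
  small multiple of \<open>form\<close>.\<close>

lemma exponent_eq: "exponent x = u / p * abscissa x + of_int (fst x) * form / p"
  using p_pos by (simp add: exponent_def abscissa_def form_def field_simps)

text \<open>The unit \<open>exp u\<close> needs no denominator, and \<open>exp (j * v)\<close> needs
  \<open>y\<close> to the power \<open>\<bar>j\<bar>\<close>; the surplus power of \<open>y\<close>
  is an integer.\<close>

lemma exponent_conj_pair:
  assumes "\<bar>fst x\<bar> \<le> int J"
  shows "conj_pair (real_of_int y ^ J * exp (exponent x)) (real_of_int y ^ J * exp (- exponent x))"
proof -
  obtain j i where x: "x = (j, i)" by (cases x)
  have "exp (- u) = 3 - 2 * sqrt 2"
    unfolding exp_minus exp_u by (rule inverse_unique) (simp add: algebra_simps)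
  then have "conj_pair (1 * exp u) (1 * exp (- u))"
    unfolding exp_u by (intro conj_pairI[of _ 3 2]) simp_all
  from conj_pair_exp_int[OF this, of i]
  have 1: "conj_pair (exp (i * u)) (exp (- (i * u)))" by simp
  have "conj_pair (y * exp v) (y * exp (- v))"
    unfolding exp_v exp_minus_v
    by (rule conj_pairI[of _ "a\<^sup>2 + 2 * b\<^sup>2" "2 * a * b"]) (simp_all add: power2_eq_square algebra_simps)
  from conj_pair_exp_int[OF this, of j]
  have 2: "conj_pair (y ^ nat \<bar>j\<bar> * exp (j * v)) (y ^ nat \<bar>j\<bar> * exp (- (j * v)))" by simp
  have 3: "conj_pair (y ^ (J - nat \<bar>j\<bar>)) (y ^ (J - nat \<bar>j\<bar>))"
    using conj_pair_of_int[of "y ^ (J - nat \<bar>j\<bar>)"] by simp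
  have "J = (J - nat \<bar>j\<bar>) + nat \<bar>j\<bar>" using assms x by simp
  then have yJ: "real_of_int y ^ J = real_of_int y ^ (J - nat \<bar>j\<bar>) * real_of_int y ^ nat \<bar>j\<bar>"
    by (metis power_add)
  show ?thesis
    using conj_pair_mult[OF conj_pair_mult[OF 3 2] 1]
    unfolding yJ by (simp add: x exponent_def exp_add exp_diff exp_minus field_simps)
qed

definition column :: "nat \<Rightarrow> int \<times> int \<Rightarrow> real" where
  "column m x = (abscissa x gchoose (m div 5)) * hyp_basis (m mod 5) (exponent x)"

lemma column_Ints:
  assumes "\<bar>fst x\<bar> \<le> int J"
  shows "real_of_int y ^ (J * hyp_freq (m mod 5)) * column m x \<in> \<int>"
proof -
  have "(abscissa x gchoose (m div 5)) * ((real_of_int y ^ J) ^ hyp_freq (m mod 5) * hyp_basis (m mod 5) (exponent x)) \<in> \<int>"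
    unfolding abscissa_def
    by (intro Ints_mult gbinomial_of_int_in_Ints hyp_basis_Ints exponent_conj_pair assms)
  then show ?thesis by (simp add: column_def power_mult mult_ac)
qed

text \<open>Up to the factor \<open>exp t ^ 2\<close>, a relation among the columns is a polynomial
  in the abscissa and in \<open>exp\<close> of the exponent. Raising \<open>j\<close> by one shifts
  the former by \<open>- r\<close> and multiplies the latter by \<open>exp v\<close>, so the five
  translates feed the zero estimate, which allows at most \<open>(K - 1) * 5\<close>
  abscissas.\<close>

lemma columns_independent:
  assumes inj: "inj_on abscissa Q" and card: "card Q > (K - 1) * 5"
    and van: "\<And>j i t. (j, i) \<in> Q \<Longrightarrow> t < 5 \<Longrightarrow> (\<Sum>m<5 * K. c m * column m (j + int t, i)) = 0"
    and m: "m < 5 * K"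
  shows "c m = 0"
proof (rule ccontr)
  assume cm: "c m \<noteq> 0"
  define C where "C l = (\<Sum>k<K. smult (c (5 * k + l)) (binomial_poly k))" for l
  have C_ne: "C (m mod 5) \<noteq> 0"
  proof
    assume "C (m mod 5) = 0"
    from binomial_poly_independent[OF this[unfolded C_def], of "m div 5"] m cm show False
      by (simp add: less_mult_imp_div_less mult.commute)
  qed
  have degC: "degree (C l) \<le> K - 1" for l
    unfolding C_def
  proof (rule degree_sum_le)
    fix k assume "k \<in> {..<K}"
    then show "degree (smult (c (5 * k + l)) (binomial_poly k)) \<le> K - 1"
      using degree_binomial_poly_le[of k] by (auto intro: order_trans[OF degree_smult_le])
  qed simp
  have sum: "(\<Sum>m<5 * K. c m * column m x) = (\<Sum>l<5. poly (C l) (abscissa x) * hyp_basis l (exponent x))" for x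
  proof -
    have "(\<Sum>m<5 * K. c m * column m x) = (\<Sum>m<5 * K. c (5 * (m div 5) + m mod 5)
        * ((abscissa x gchoose (m div 5)) * hyp_basis (m mod 5) (exponent x)))"
      by (simp add: column_def)
    also have "\<dots> = (\<Sum>k<K. \<Sum>l<5. c (5 * k + l) * ((abscissa x gchoose k) * hyp_basis l (exponent x)))"
      by (rule sum_div_mod_5)
    also have "\<dots> = (\<Sum>l<5. \<Sum>k<K. c (5 * k + l) * ((abscissa x gchoose k) * hyp_basis l (exponent x)))"
      by (rule sum.swap)
    also have "\<dots> = (\<Sum>l<5. poly (C l) (abscissa x) * hyp_basis l (exponent x))"
      by (simp add: C_def poly_sum poly_binomial_poly sum_distrib_right mult.assoc)
    finally show ?thesis .
  qed
  \<comment> \<open>The coefficients with respect to powers of \<open>exp t\<close>, as in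
    \<open>hyp_basis_combination\<close>.\<close>
  define q where "q l = (
     if l = 0 then smult (1 / 2) (C 2) - smult (1 / (2 * sqrt 2)) (C 4)
     else if l = 1 then smult (1 / 2) (C 1) - smult (1 / (2 * sqrt 2)) (C 3)
     else if l = 2 then C 0
     else if l = 3 then smult (1 / 2) (C 1) + smult (1 / (2 * sqrt 2)) (C 3)
     else smult (1 / 2) (C 2) + smult (1 / (2 * sqrt 2)) (C 4))" for l :: nat
  define P where "P = (\<lambda>x. (abscissa x, exp (exponent x))) ` Q"
  have "card (fst ` P) \<le> (K - 1) * 5"
  proof (rule card_common_zeros_of_translates_le[where q = q and \<gamma> = "exp v" and s = "- real_of_int r"])
    show "degree (q l) \<le> K - 1" for l
      unfolding q_def using degC
      by (auto intro!: degree_add_le degree_diff_le order_trans[OF degree_smult_le])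
    show "\<exists>l<5. q l \<noteq> 0"
    proof (rule ccontr)
      assume "\<not> (\<exists>l<5. q l \<noteq> 0)"
      then have q0: "q 0 = 0" "q 1 = 0" "q 2 = 0" "q 3 = 0" "q 4 = 0" by auto
      \<comment> \<open>The change from the hyperbolic to the exponential basis is invertible for
        each pair of opposite frequencies.\<close>
      have split: "A = 0 \<and> B = 0"
        if "smult (1 / 2) A - smult (1 / (2 * sqrt 2)) B = 0" "smult (1 / 2) A + smult (1 / (2 * sqrt 2)) B = 0"
        for A B :: "real poly"
      proof -
        have "coeff A n / 2 - coeff B n / (2 * sqrt 2) = 0" "coeff A n / 2 + coeff B n / (2 * sqrt 2) = 0" for n
          using arg_cong[OF that(1), of "\<lambda>p. coeff p n"] arg_cong[OF that(2), of "\<lambda>p. coeff p n"] by simp_all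
        moreover have "s = 0 \<and> t = 0" if "s - t = 0" "s + t = 0" for s t :: real
          using that by linarith
        ultimately have "coeff A n / 2 = 0 \<and> coeff B n / (2 * sqrt 2) = 0" for n by blast
        then show ?thesis by (simp add: poly_eq_iff)
      qed
      have "C 0 = 0" using q0(3) by (simp add: q_def)
      moreover have "C 1 = 0 \<and> C 3 = 0" by (rule split) (use q0 in \<open>simp_all add: q_def\<close>)
      moreover have "C 2 = 0 \<and> C 4 = 0" by (rule split) (use q0 in \<open>simp_all add: q_def\<close>)
      ultimately have C0: "C 0 = 0" "C 1 = 0" "C 2 = 0" "C 3 = 0" "C 4 = 0" by simp_all
      have "m mod 5 = 0 \<or> m mod 5 = 1 \<or> m mod 5 = 2 \<or> m mod 5 = 3 \<or> m mod 5 = 4"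
        by presburger
      then show False using C0 C_ne by (elim disjE) (simp_all only:)
    qed
    show "exp v > 0" "exp v \<noteq> 1" using v_ne_0 by auto
    show "w \<noteq> 0" if "(z, w) \<in> P" for z w using that by (auto simp: P_def)
    show "(\<Sum>l<5. poly (q l) (z + real t * - real_of_int r) * (exp v ^ t * w) ^ l) = 0"
      if zw: "(z, w) \<in> P" and t: "t < 5" for z w t
    proof -
      obtain j i where ji: "(j, i) \<in> Q" "z = abscissa (j, i)" "w = exp (exponent (j, i))"
        using zw by (auto simp: P_def)
      define x where "x = (j + int t, i)"
      have z: "z + real t * - real_of_int r = abscissa x"
        by (simp add: ji x_def abscissa_def algebra_simps)
      have w: "exp v ^ t * w = exp (exponent x)"
        by (simp add: ji x_def exponent_def exp_of_nat_mult[symmetric] exp_add[symmetric] algebra_simps)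
      have "(\<Sum>l<5. poly (q l) (abscissa x) * exp (exponent x) ^ l)
          = exp (exponent x) ^ 2 * (\<Sum>l<5. poly (C l) (abscissa x) * hyp_basis l (exponent x))"
        unfolding hyp_basis_combination by (rule sum.cong) (auto simp: q_def)
      also have "\<dots> = 0" using van[OF ji(1) t] by (simp add: sum flip: x_def)
      finally show ?thesis unfolding z w .
    qed
  qed
  moreover have "fst ` P = abscissa ` Q" by (simp add: P_def image_image)
  ultimately show False using card by (simp add: card_image[OF inj])
qed

text \<open>Two bounds for one determinant: multiplied by the column denominators it is a nonzero
  integer, while interpolation in the single variable \<open>abscissa\<close> makes it
  small.\<close>

lemma interpolation_inequality:
  fixes K J R :: nat and \<rho> x :: real
  assumes J: "J \<ge> 2" "2 * J < p" and R: "R \<ge> 1" and card: "(2 * J - 3) * R > (K - 1) * 5"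
    and \<rho>: "\<rho> \<ge> 1" and small: "exp (2 * J * \<bar>form\<bar> / p) - 1 \<le> 1 / \<rho> ^ (5 * K)"
    and x: "x = \<rho> * (p * (R / 2 + 1))"
  shows "1 \<le> (\<Prod>m<5 * K. real_of_int y ^ (J * hyp_freq (m mod 5))) * (fact (5 * K) *
    (\<Prod>m<5 * K. 2 * ((\<Prod>i<m div 5. x + real i) / fact (m div 5) * exp (hyp_freq (m mod 5) * (u / p) * x)))
      / \<rho> ^ (\<Sum>{..<5 * K}))"
proof -
  \<comment> \<open>The windows of length \<open>R\<close> contribute p R / 2 to the abscissas, and
    the five translates at most 2 |r|, which is at most p.\<close>
  define Z where "Z = p * (real R / 2 + 1)"
  define P where "P = {x. \<bar>fst x\<bar> \<le> int J \<and> \<bar>abscissa x\<bar> \<le> Z}"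
  define G where "G m = (\<Prod>i<m div 5. x + real i) / fact (m div 5) * exp (hyp_freq (m mod 5) * (u / p) * x)" for m
  have Z0: "Z \<ge> 0" by (simp add: Z_def)
  have xZ: "x = \<rho> * Z" by (simp add: x Z_def)
  have Zx: "Z \<le> x" using \<rho> Z0 mult_right_mono[of 1 \<rho> Z] by (simp add: xZ)
  \<comment> \<open>For each \<open>j\<close> the \<open>R\<close> values of \<open>i\<close> are
    centred at (j + 2) r / p, which makes the abscissa small at the middle one of the translates j,
    ..., j + 4.\<close>
  define s where "s j = \<lceil>of_int (j + 2) * of_int r / real p - real R / 2\<rceil>" for j :: int
  \<comment> \<open>The range ends at \<open>J - 4\<close> so that all five translates stay within
    absolute value \<open>J\<close>.\<close>
  define Q where "Q = (SIGMA j:{- int J..int J - 4}. {s j..<s j + int R})"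
  have cardQ: "card Q = (2 * J - 3) * R"
  proof -
    have "nat (2 * int J - 3) = 2 * J - 3" by simp
    then show ?thesis by (simp add: Q_def)
  qed
  \<comment> \<open>Modulo \<open>p\<close> the abscissa determines \<open>j\<close>, as
    \<open>r\<close> is invertible and the range of \<open>j\<close> is shorter than
    \<open>p\<close>.\<close>
  have inj: "inj_on abscissa Q"
  proof (rule inj_onI)
    fix x x' assume xx: "x \<in> Q" "x' \<in> Q" "abscissa x = abscissa x'"
    obtain j i j' i' where e: "x = (j, i)" "x' = (j', i')" by (cases x; cases x')
    have eq: "int p * (i - i') = r * (j - j')"
      using xx(3) unfolding abscissa_def e of_int_eq_iff by (simp add: algebra_simps)
    then have "int p dvd r * (j - j')" by (metis dvd_triv_left)
    then have "int p dvd j - j'" using coprime_r_p by (simp add: coprime_commute coprime_dvd_mult_right_iff)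
    moreover have "\<bar>j - j'\<bar> < int p" using xx J unfolding e Q_def by auto
    ultimately have "j = j'" using zdvd_imp_le[of "int p" "\<bar>j - j'\<bar>"] by force
    then show "x = x'" using eq p_pos by (simp add: e)
  qed
  have QP: "(j + int t, i) \<in> P" if q: "(j, i) \<in> Q" and t: "t < 5" for j i t
  proof -
    define w where "w = of_int (j + 2) * of_int r / real p"
    have "w - real R / 2 \<le> s j" "s j < w - real R / 2 + 1" unfolding s_def w_def by linarith+
    moreover have "s j \<le> i" "i \<le> s j + int R - 1" using q by (auto simp: Q_def)
    ultimately have "\<bar>of_int i - w\<bar> \<le> real R / 2" by linarith
    from mult_left_mono[OF this, of "real p"]
    have "\<bar>p * (of_int i - w)\<bar> \<le> p * (real R / 2)" by (simp add: abs_mult)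
    moreover have "p * (of_int i - w) = of_int (int p * i - r * (j + 2))"
      using p_pos by (simp add: w_def field_simps)
    moreover have "abscissa (j + int t, i) = of_int (int p * i - r * (j + 2)) + of_int (r * (2 - int t))"
      by (simp add: abscissa_def algebra_simps)
    moreover have "\<bar>real_of_int (r * (2 - int t))\<bar> \<le> p"
    proof -
      have "\<bar>r * (2 - int t)\<bar> \<le> \<bar>r\<bar> * 2"
        unfolding abs_mult using t by (intro mult_left_mono) auto
      then show ?thesis using r_le by linarith
    qed
    ultimately have "\<bar>abscissa (j + int t, i)\<bar> \<le> p * (real R / 2) + p" by linarith
    then show ?thesis using q t by (auto simp: P_def Z_def Q_def algebra_simps)
  qed
  have "\<exists>xs. (\<forall>i<5 * K. xs i \<in> P) \<and> det (mat (5 * K) (5 * K) (\<lambda>(i, j). column j (xs i))) \<noteq> 0"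
  proof (rule exists_points_det_ne_0, intro allI impI)
    fix c m assume "\<And>x. x \<in> P \<Longrightarrow> (\<Sum>j<5 * K. c j * column j x) = 0" "m < 5 * K"
    then show "c m = 0"
      using columns_independent[OF inj, of K c m] card QP by (simp add: cardQ)
  qed
  then obtain xs where xs: "\<And>i. i < 5 * K \<Longrightarrow> xs i \<in> P"
    and det: "det (mat (5 * K) (5 * K) (\<lambda>(i, j). column j (xs i))) \<noteq> 0" (is "?D \<noteq> 0") by blast
  define Y where "Y = (\<Prod>m<5 * K. real_of_int y ^ (J * hyp_freq (m mod 5)))"
  have Y: "Y > 0" unfolding Y_def using y_gt_1 by (intro prod_pos) auto
  have "Y * ?D \<in> \<int>"
    unfolding Y_def by (rule det_column_scaled_Ints[of _ _ "\<lambda>i j. column j (xs i)"])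
      (use xs in \<open>auto intro!: column_Ints simp: P_def\<close>)
  then have "1 \<le> \<bar>Y * ?D\<bar>" using det Y by (intro Ints_nonzero_abs_ge1) auto
  also have "\<dots> = Y * \<bar>?D\<bar>" using Y by (simp add: abs_mult)
  also have "\<bar>?D\<bar> \<le> fact (5 * K) * (\<Prod>m<5 * K. 2 * G m) / \<rho> ^ (\<Sum>{..<5 * K})"
  proof (rule abs_interpolation_det_le[where Z = Z and z = "\<lambda>i. abscissa (xs i)"
        and f = "\<lambda>m z. (z gchoose (m div 5)) * hyp_basis (m mod 5) (u / p * z)", OF _ _ _ \<rho> Z0])
    show "majorised (\<lambda>z. (z gchoose (m div 5)) * hyp_basis (m mod 5) (u / p * z)) (\<rho> * Z) (G m)" for m
      unfolding G_def xZ[symmetric] using u_nonneg Zx Z0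
      by (intro majorised_gbinomial_mult majorised_hyp_basis) auto
    show "\<bar>abscissa (xs i)\<bar> \<le> Z" if "i < 5 * K" for i using xs[OF that] by (simp add: P_def)
    fix i m assume i: "i < 5 * K" and m: "m < 5 * K"
    define l where "l = m mod 5"
    have l: "l < 5" by (simp add: l_def)
    define A h where "A = u / p * abscissa (xs i)" and "h = of_int (fst (xs i)) * form / p"
    have Pi: "\<bar>fst (xs i)\<bar> \<le> int J" "\<bar>abscissa (xs i)\<bar> \<le> Z" using xs[OF i] by (auto simp: P_def)
    have Ale: "\<bar>A\<bar> \<le> u / p * x"
      unfolding A_def abs_mult using u_nonneg Pi Zx by (intro mult_mono) auto
    have "real (hyp_freq l) * \<bar>h\<bar> \<le> 2 * (J * \<bar>form\<bar> / p)"
    proof (intro mult_mono)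
      have "\<bar>real_of_int (fst (xs i))\<bar> \<le> J" using Pi(1) by linarith
      then show "\<bar>h\<bar> \<le> J * \<bar>form\<bar> / p"
        unfolding h_def by (simp add: abs_mult divide_right_mono mult_right_mono)
      show "real (hyp_freq l) \<le> 2" using hyp_freq_le[OF l] by simp
    qed auto
    then have "exp (real (hyp_freq l) * \<bar>h\<bar>) - 1 \<le> exp (2 * J * \<bar>form\<bar> / p) - 1" by simp
    then have hle: "exp (real (hyp_freq l) * \<bar>h\<bar>) - 1 \<le> 1 / \<rho> ^ (5 * K)" using small by linarith
    have "\<bar>column m (xs i) - (abscissa (xs i) gchoose (m div 5)) * hyp_basis l A\<bar>
      = \<bar>abscissa (xs i) gchoose (m div 5)\<bar> * \<bar>hyp_basis l (A + h) - hyp_basis l A\<bar>"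
      unfolding column_def l_def[symmetric] exponent_eq A_def[symmetric] h_def[symmetric]
      by (simp add: right_diff_distrib[symmetric] abs_mult)
    also have "\<dots> \<le> ((\<Prod>i<m div 5. x + real i) / fact (m div 5))
        * (exp (real (hyp_freq l) * (u / p * x)) * (1 / \<rho> ^ (5 * K)))"
    proof (rule mult_mono)
      show "\<bar>abscissa (xs i) gchoose (m div 5)\<bar> \<le> (\<Prod>i<m div 5. x + real i) / fact (m div 5)"
        by (rule abs_gbinomial_le) (use Pi Zx in linarith)
      show "\<bar>hyp_basis l (A + h) - hyp_basis l A\<bar>
          \<le> exp (real (hyp_freq l) * (u / p * x)) * (1 / \<rho> ^ (5 * K))"
      proof (rule order_trans[OF abs_hyp_basis_add_diff_le], rule mult_mono)
        show "exp (real (hyp_freq l) * \<bar>A\<bar>) \<le> exp (real (hyp_freq l) * (u / p * x))"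
          using mult_left_mono[OF Ale, of "real (hyp_freq l)"] by simp
      qed (use hle in auto)
      show "0 \<le> (\<Prod>i<m div 5. x + real i) / fact (m div 5)"
        using Zx Z0 by (intro divide_nonneg_pos prod_nonneg) auto
    qed simp
    also have "\<dots> = G m / \<rho> ^ (5 * K)" by (simp add: G_def l_def mult.assoc)
    finally show "\<bar>column m (xs i) - (abscissa (xs i) gchoose (m div 5)) *
        hyp_basis (m mod 5) (u / p * abscissa (xs i))\<bar> \<le> G m / \<rho> ^ (5 * K)"
      by (simp add: A_def l_def)
  qed
  finally show ?thesis using Y unfolding Y_def G_def by (simp add: mult_left_mono)
qed

end

section \<open>Numerical estimates\<close>

lemma exp_1_bounds: "2718 / 1000 \<le> exp (1::real)" "exp (1::real) \<le> 2719 / 1000"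
proof -
  \<comment> \<open>The eight Taylor terms sum to 13700 / 5040, and the remainder lies between 0 and
    3 / 40320.\<close>
  obtain t :: real where t: "\<bar>t\<bar> \<le> 1" "exp 1 = (\<Sum>m<8. 1 ^ m / fact m) + exp t / fact 8 * 1 ^ 8"
    using Maclaurin_exp_le[of 1 8] by auto
  have "exp t \<le> exp 1" using t(1) by simp
  then have "exp t \<le> 3" using exp_le by linarith
  moreover have "exp t > 0" by simp
  moreover have "exp (1::real) = 13700 / 5040 + exp t / 40320"
    unfolding t(2) by (simp add: eval_nat_numeral fact_numeral)
  ultimately show "2718 / 1000 \<le> exp (1::real)" "exp (1::real) \<le> 2719 / 1000" by linarith+
qed

text \<open>Reduces rational bounds for logarithms to comparing powers of rational numbers.\<close>

lemma ln_ge_of_power: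
  assumes "x > 0" "b > 0" "(2719 / 1000) ^ a \<le> x ^ b"
  shows "real a / real b \<le> ln x"
proof -
  have "exp (real a) \<le> x ^ b"
    using power_mono[OF exp_1_bounds(2), of a] assms(3) by (simp add: exp_of_nat_mult[symmetric])
  then have "real a \<le> real b * ln x"
    using assms by (metis exp_gt_zero ln_exp ln_le_cancel_iff ln_realpow zero_less_power)
  then show ?thesis using assms by (simp add: field_simps)
qed

lemma ln_le_of_power:
  assumes "x > 0" "b > 0" "x ^ b \<le> (2718 / 1000) ^ a"
  shows "ln x \<le> real a / real b"
proof -
  have "x ^ b \<le> exp (real a)"
    using power_mono[OF exp_1_bounds(1), of a] assms(3) by (simp add: exp_of_nat_mult[symmetric])
  then have "real b * ln x \<le> real a"
    using assms by (metis exp_gt_zero ln_exp ln_le_cancel_iff ln_realpow zero_less_power)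
  then show ?thesis using assms by (simp add: field_simps)
qed

text \<open>The number 16 is a lower bound for \<open>\<rho>\<close> and 7 one for \<open>y\<close>;
  583/100 exceeds 3 + 2 sqrt 2, and 117/5 is the constant in the estimate of
  \<open>W\<close>.\<close>

lemma ln_bounds:
  "11 / 4 \<le> ln (16::real)" "ln (16::real) \<le> 14 / 5" "19 / 10 \<le> ln (7::real)"
  "ln (583 / 100 :: real) \<le> 9 / 5" "ln (117 / 5 :: real) \<le> 16 / 5"
  using ln_ge_of_power[of 16 4 11] ln_le_of_power[of 16 5 14] ln_ge_of_power[of 7 10 19]
    ln_le_of_power[of "583 / 100" 5 9] ln_le_of_power[of "117 / 5" 5 16]
  by (simp_all add: field_simps)

text \<open>The tangent to the concave function \<open>ln\<close> at \<open>c\<close>.\<close>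

lemma ln_le_linear:
  fixes x c :: real
  assumes "x > 0" "c > 0"
  shows "ln x \<le> x / c + ln c - 1"
  using ln_le_minus_one[of "x / c"] assms by (simp add: ln_div)

section \<open>The numerical contradiction\<close>

text \<open>Divided by 5 K, the left side of \<open>main\<close> is about T / 4 with T = p Y. The
  main terms on the right are 6/5 of T / 33 from the denominators, 0.154 T from the binomials and
  6/5 of 0.0338 T from exponential growth, together below 0.231 T. The lower-order terms add less
  than 0.008 T.\<close>

lemma parameter_contradiction:
  fixes p Y K R J u \<rho> lam X W :: real
  assumes p: "p \<ge> 1952" and Y: "Y \<ge> 19 / 10" and \<rho>: "\<rho> = p / 122" and lam: "lam = ln \<rho>"
    and K: "K \<le> p * Y / (10 * lam)" "K \<ge> p * Y / (10 * lam) - 1"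
    and R: "R \<ge> 3 * Y" "R \<le> 3 * Y + 1" and J: "J \<le> 5 * K / (2 * R) + 3"
    and u: "0 \<le> u" "u \<le> 9 / 5" and X: "X = R / 2 + 1" and W: "W = \<rho> * (p * X) + K"
    and main: "5 * K * (5 * K - 1) / 2 * lam \<le> 6 * K * J * Y + 5 * K * ln (10 * K)
      + 5 * (K * (K - 1) / 2 * ln W - (K - 1)\<^sup>2 / 2 * (ln (K - 1) - 3 / 2)) + 6 * K * (u * \<rho> * X)"
  shows False
proof -
  define T where "T = p * Y"
  have rho: "\<rho> \<ge> 16" using p \<rho> by simp
  have lam1: "lam \<ge> 11 / 4"
    using rho ln_bounds(1) unfolding lam by (smt (verit) ln_le_cancel_iff)
  have lam2: "lam \<le> 7 / 40 * \<rho>"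
    using ln_le_linear[of \<rho> 16] ln_bounds(2) rho unfolding lam by simp
  have Tp: "T \<ge> 19 / 10 * p" unfolding T_def using p Y mult_left_mono[of "19/10" Y p] by simp
  have T1: "T \<ge> 3708" using Tp p by simp
  have T2: "T \<ge> 1320 * lam" using Tp lam2 \<rho> p by simp
  have YT: "Y \<le> T / 1952" unfolding T_def using p Y mult_right_mono[of 1952 p Y] by simp
  have Klam: "K * lam \<le> T / 10" "K * lam \<ge> T / 10 - lam"
    using K lam1 unfolding T_def by (simp_all add: field_simps)
  define n where "n = K - 1"
  have n_ge: "n * lam \<ge> 98 / 1000 * T"
  proof -
    have "n * lam = K * lam - lam" by (simp add: n_def algebra_simps)
    then show ?thesis using Klam(2) T2 lam1 by linarith
  qed
  have n1: "n \<ge> 100"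
  proof (rule ccontr)
    assume "\<not> n \<ge> 100"
    then have "n * lam < 100 * lam" using lam1 by simp
    then show False using n_ge T2 lam1 by linarith
  qed
  have K1: "K \<ge> 101" using n1 by (simp add: n_def)
  have KT: "10 * K \<le> T"
  proof -
    have "K * 1 \<le> K * lam" using K1 lam1 by (intro mult_left_mono) auto
    then show ?thesis using Klam(1) by simp
  qed
  \<comment> \<open>Tangent at \<open>exp 8\<close>, of the order of the least possible
    \<open>T\<close>; the constant has to exceed 1 / 2970 + 7 / 3708.\<close>
  have lnT: "ln T \<le> 225 / 100000 * T"
  proof -
    have "(2970::real) \<le> (2718 / 1000) ^ 8" by (simp add: field_simps)
    also have "\<dots> \<le> exp 1 ^ 8" by (rule power_mono[OF exp_1_bounds(1)]) simp
    also have "\<dots> = exp 8" by (simp add: exp_of_nat_mult[symmetric])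
    finally have "(2970::real) \<le> exp 8" .
    then have "T / exp 8 \<le> T / 2970" using T1 by (intro divide_left_mono) auto
    then show ?thesis using ln_le_linear[of T "exp 8"] T1 by simp
  qed
  have X2: "X \<le> 229 / 100 * Y" using X R Y by simp
  have X0: "X > 0" using X R Y by simp
  have b1: "(5 * K - 1) / 2 * lam \<ge> T / 4 - 3 * lam"
    using Klam(2) by (simp add: algebra_simps)
  have b2: "J * Y \<le> T / 33 + 3 * Y"
  proof -
    have "J * Y \<le> (5 * K / (2 * R) + 3) * Y" using J Y by (intro mult_right_mono) auto
    also have "\<dots> = 5 * K * (Y / R) / 2 + 3 * Y" by (simp add: field_simps)
    also have "5 * K * (Y / R) / 2 \<le> 5 * K * (1 / 3) / 2"
      using K1 R Y by (intro divide_right_mono mult_left_mono) (auto simp: field_simps)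
    also have "\<dots> \<le> T / 33"
    proof -
      have "K * (11 / 4) \<le> K * lam" using K1 lam1 by (intro mult_left_mono) auto
      then show ?thesis using Klam(1) by simp
    qed
    finally show ?thesis by simp
  qed
  have b3: "u * \<rho> * X \<le> 338 / 10000 * T"
  proof -
    have "u * \<rho> * X \<le> 9 / 5 * \<rho> * (229 / 100 * Y)"
      using u rho X2 X0 by (intro mult_mono) auto
    also have "\<dots> = (9 / 5 * 229 / 12200) * T" by (simp add: \<rho> T_def)
    also have "\<dots> \<le> 338 / 10000 * T" using T1 by (intro mult_right_mono) auto
    finally show ?thesis .
  qed
  \<comment> \<open>Only the ratio of \<open>W\<close> to \<open>n\<close> matters. The constant
    117/5 covers 2.29 / 0.098 and a small contribution of the summand \<open>K\<close>.\<close>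
  have Wn: "W \<le> 117 / 5 * (\<rho> * lam) * n"
  proof -
    have "\<rho> * (p * X) \<le> \<rho> * (p * (229 / 100 * Y))"
      using rho p X2 by (intro mult_left_mono) auto
    also have "\<dots> = 229 / 100 * (\<rho> * T)" by (simp add: T_def)
    finally have 1: "\<rho> * (p * X) \<le> 229 / 100 * (\<rho> * T)" .
    have 2: "\<rho> * (98 / 1000 * T) \<le> \<rho> * (n * lam)" using n_ge rho by (intro mult_left_mono) auto
    have 3: "16 * T \<le> \<rho> * T" using rho T1 by (intro mult_right_mono) auto
    have "K * (11 / 4) \<le> K * lam" using K1 lam1 by (intro mult_left_mono) auto
    then have "W \<le> 229 / 100 * (\<rho> * T) + T / 27" using 1 Klam(1) K1 W by linarith
    moreover have "\<rho> * (98 / 1000 * T) = 98 / 1000 * (\<rho> * T)" by simp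
    ultimately have "W \<le> 117 / 5 * (\<rho> * (n * lam))" using 2 3 T1 by linarith
    then show ?thesis by (simp add: mult_ac)
  qed
  have W0: "W > 0" unfolding W using rho p X0 K1 by (intro add_pos_pos mult_pos_pos) auto
  have lnlam: "ln lam \<le> 37 / 100 * lam"
  proof -
    have "lam / exp 1 \<le> lam / (2718 / 1000)"
      using exp_1_bounds(1) lam1 by (intro divide_left_mono) auto
    then show ?thesis using ln_le_linear[of lam "exp 1"] lam1 by simp
  qed
  have lnW: "ln W - ln n \<le> 137 / 100 * lam + 16 / 5"
  proof -
    have split: "ln (c * (\<rho> * l) * n) = ln c + ln \<rho> + ln l + ln n" if "c > 0" "l > 0" for c l
      using that rho n1 by (simp add: ln_mult)
    have "ln W \<le> ln (117 / 5 * (\<rho> * lam) * n)" using W0 Wn by simp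
    also have "\<dots> = ln (117 / 5) + lam + ln lam + ln n"
      using split[of "117 / 5" lam] lam1 by (simp only: lam[symmetric])
    finally show ?thesis using ln_bounds(5) lnlam by simp
  qed
  have lnn: "ln n \<le> ln T" "ln n \<ge> 0" "ln (10 * K) \<le> ln T" using n1 KT K1 T1 by (auto simp: n_def)
  \<comment> \<open>The \<open>ln n\<close> gained from the factorials cancels against
    \<open>ln W\<close>, leaving n / 2 times a quantity of order \<open>lam\<close>; and
    \<open>n * lam\<close> is at most T / 10.\<close>
  have b4: "(K - 1) / 2 * ln W - (K - 1)\<^sup>2 / (2 * K) * (ln (K - 1) - 3 / 2) \<le> 154 / 1000 * T + ln T / 2"
  proof -
    have g: "n\<^sup>2 / (2 * K) = n / 2 - n / (2 * K)"
      using K1 by (simp add: n_def field_simps power2_eq_square)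
    have "(K - 1) / 2 * ln W - (K - 1)\<^sup>2 / (2 * K) * (ln (K - 1) - 3 / 2)
        = n / 2 * ln W - (n / 2 - n / (2 * K)) * (ln n - 3 / 2)"
      by (simp only: g n_def[symmetric])
    also have "\<dots> = n / 2 * (ln W - ln n + 3 / 2) + n / (2 * K) * (ln n - 3 / 2)"
      by (simp add: algebra_simps)
    also have "n / (2 * K) * (ln n - 3 / 2) \<le> 1 / 2 * ln T"
    proof -
      have "n / (2 * K) * (ln n - 3 / 2) \<le> n / (2 * K) * ln n" using n1 K1 by (intro mult_left_mono) auto
      also have "\<dots> \<le> 1 / 2 * ln T"
        using n1 K1 lnn by (intro mult_mono) (auto simp: n_def field_simps)
      finally show ?thesis .
    qed
    also have "n / 2 * (ln W - ln n + 3 / 2) \<le> n / 2 * (137 / 100 * lam + 47 / 10)"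
      using lnW n1 by (intro mult_left_mono) auto
    also have "\<dots> = 137 / 200 * (n * lam) + 47 / 20 * n" by (simp add: algebra_simps)
    also have "\<dots> \<le> 154 / 1000 * T"
    proof -
      have "n * (11 / 4) \<le> n * lam" using n1 lam1 by (intro mult_left_mono) auto
      moreover have "n * lam \<le> T / 10" using Klam(1) lam1 by (simp add: n_def algebra_simps)
      ultimately show ?thesis using T1 by linarith
    qed
    finally show ?thesis by simp
  qed
  define D where "D = (K - 1)\<^sup>2 / (2 * K) * (ln (K - 1) - 3 / 2)"
  have D: "(K - 1)\<^sup>2 / 2 * (ln (K - 1) - 3 / 2) = K * D" using K1 by (simp add: D_def)
  have "5 * K * ((5 * K - 1) / 2 * lam) \<le> 5 * K * (6 / 5 * (J * Y) + ln (10 * K)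
      + ((K - 1) / 2 * ln W - D) + 6 / 5 * (u * \<rho> * X))"
    using main unfolding D by (simp add: algebra_simps)
  then have "(5 * K - 1) / 2 * lam \<le> 6 / 5 * (J * Y) + ln (10 * K)
      + ((K - 1) / 2 * ln W - D) + 6 / 5 * (u * \<rho> * X)"
    using K1 by (subst (asm) mult_le_cancel_left_pos) auto
  then show False using b1 b2 b3 b4[folded D_def] lnn lnT YT T2 T1 by linarith
qed

section \<open>Products of factorials\<close>

text \<open>Comparison with an integral: t^2 / 2 (ln t - 3/2) has derivative t ln t - t, and ln (m!)
  is at least m ln m - m.\<close>

lemma superfactorial_lower_bound:
  "real n ^ 2 / 2 * (ln (real n) - 3 / 2) \<le> (\<Sum>k<Suc n. ln (fact k))"
proof (induction n)
  case (Suc n)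
  define h where "h t = t ^ 2 / 2 * (ln t - 3 / 2)" for t :: real
  have fact: "real m * ln (real m) - real m \<le> ln (fact m)" for m
  proof (induction m)
    case (Suc m)
    show ?case
    proof (cases "m = 0")
      case False
      then have "ln (real (Suc m)) - ln (real m) \<le> 1 / real m"
        using ln_le_minus_one[of "real (Suc m) / real m"] by (simp add: ln_div field_simps)
      from mult_left_mono[OF this, of "real m"] have "real m * ln (real (Suc m)) - real m * ln (real m) \<le> 1"
        using False by (simp add: algebra_simps)
      moreover have "ln (fact (Suc m) :: real) = ln (real (Suc m)) + ln (fact m)"
        by (simp add: ln_mult)
      ultimately show ?thesis using Suc by (simp add: algebra_simps)
    qed simp
  qed simp
  have step: "h (real (Suc n)) - h (real n) \<le> real (Suc n) * ln (real (Suc n)) - real (Suc n)"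
    if False: "n \<noteq> 0"
  proof -
    have "\<exists>t>real n. t < real (Suc n) \<and> h (real (Suc n)) - h (real n)
        = (real (Suc n) - real n) * (t * ln t - t)"
    proof (rule MVT2)
      fix t assume "real n \<le> t" "t \<le> real (Suc n)"
      then have "t > 0" using False by simp
      then show "(h has_real_derivative t * ln t - t) (at t)"
        unfolding h_def by (auto intro!: derivative_eq_intros simp: field_simps power2_eq_square)
    qed simp
    then obtain t where t: "t > real n" "t < real (Suc n)"
      "h (real (Suc n)) - h (real n) = t * (ln t - 1)" by (auto simp: algebra_simps)
    have "t * (ln t - 1) \<le> real (Suc n) * (ln (real (Suc n)) - 1)"
    proof (cases "ln (real (Suc n)) \<ge> 1")
      case True
      have "t * (ln t - 1) \<le> t * (ln (real (Suc n)) - 1)"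
        using t False by (intro mult_left_mono) auto
      also have "\<dots> \<le> real (Suc n) * (ln (real (Suc n)) - 1)"
        using t True by (intro mult_right_mono) auto
      finally show ?thesis .
    next
      \<comment> \<open>Here n + 1 is less than e, so n = 1, and t ln t - t still increases on
        [1, 2], its derivative being \<open>ln\<close>.\<close>
      case F: False
      have "n = 1"
      proof (rule ccontr)
        assume "n \<noteq> 1"
        then have "real (Suc n) \<ge> 3" using False by simp
        then have "exp 1 \<le> real (Suc n)" using exp_le by linarith
        then show False using F by (metis exp_gt_zero ln_exp ln_le_cancel_iff of_nat_0_less_iff zero_less_Suc)
      qed
      then have t1: "1 < t" "t < 2" using t by auto
      have d: "\<exists>s>t. s < 2 \<and> 2 * ln 2 - 2 - (t * ln t - t) = (2 - t) * ln s"
        by (rule MVT2[of t 2 "\<lambda>t. t * ln t - t" ln])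
          (use t1 in \<open>auto intro!: derivative_eq_intros\<close>)
      then obtain s where "s > t" "2 * ln 2 - 2 - (t * ln t - t) = (2 - t) * ln s" by auto
      moreover have "(2 - t) * ln s \<ge> 0" using t1 \<open>s > t\<close> by (intro mult_nonneg_nonneg) auto
      ultimately show ?thesis using \<open>n = 1\<close> by (simp add: algebra_simps)
    qed
    then show ?thesis using t(3) by (simp add: algebra_simps)
  qed
  show ?case
  proof (cases "n = 0")
    case False
    have "h (real n) \<le> (\<Sum>k<Suc n. ln (fact k))" using Suc by (simp only: h_def)
    then have "h (real (Suc n)) \<le> (\<Sum>k<Suc n. ln (fact k)) + ln (fact (Suc n))"
      using step[OF False] fact[of "Suc n"] by linarith
    then show ?thesis by (simp only: h_def sum.lessThan_Suc)
  qed simp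
qed simp

section \<open>The equation\<close>

lemma sum_hyp_freq: "(\<Sum>l<5. real (hyp_freq l)) = 6"
  by (simp add: hyp_freq_def eval_nat_numeral)

context linear_form
begin

text \<open>The logarithm of \<open>interpolation_inequality\<close>. Frequencies sum to 6 over each
  block of five columns, every factor \<open>x + i\<close> is at most \<open>W\<close>, and the
  factors 2 join the bound \<open>(5 * K) ^ (5 * K)\<close> for the factorial to give
  \<open>ln (10 * K)\<close>.\<close>

lemma log_inequality:
  fixes K J R :: nat and \<rho> X W :: real
  assumes J: "J \<ge> 2" "2 * J < p" and R: "R \<ge> 1" and card: "(2 * J - 3) * R > (K - 1) * 5"
    and \<rho>: "\<rho> \<ge> 1" and small: "exp (2 * J * \<bar>form\<bar> / p) - 1 \<le> 1 / \<rho> ^ (5 * K)"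
    and X: "X = R / 2 + 1" and W: "W = \<rho> * (p * X) + K" and K: "K \<ge> 1"
  shows "5 * real K * (5 * real K - 1) / 2 * ln \<rho> \<le> 6 * real K * J * ln y + 5 * real K * ln (10 * real K)
      + 5 * (real K * (real K - 1) / 2 * ln W - (real K - 1)\<^sup>2 / 2 * (ln (real K - 1) - 3 / 2))
      + 6 * real K * (u * \<rho> * X)"
proof -
  define x where "x = \<rho> * (p * (R / 2 + 1))"
  have x0: "x > 0" using p_pos \<rho> by (simp add: x_def add_nonneg_pos)
  have Wx: "W = x + K" by (simp add: W X x_def)
  define A where "A = (\<Prod>m<5 * K. real_of_int y ^ (J * hyp_freq (m mod 5)))"
  define G where "G m = 2 * ((\<Prod>i<m div 5. x + real i) / fact (m div 5) * exp (hyp_freq (m mod 5) * (u / p) * x))" for m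
  define B where "B = (\<Prod>m<5 * K. G m)"
  define C where "C = \<rho> ^ (\<Sum>{..<5 * K})"
  have P0: "(\<Prod>i<k. x + real i) > 0" for k using x0 by (intro prod_pos) auto
  have G0: "G m > 0" for m using P0 by (simp add: G_def)
  have A0: "A > 0" unfolding A_def using y_gt_1 by (intro prod_pos) auto
  have B0: "B > 0" unfolding B_def using G0 by (intro prod_pos) auto
  have C0: "C > 0" unfolding C_def using \<rho> by simp
  have "1 \<le> A * (fact (5 * K) * B / C)"
    unfolding A_def B_def C_def G_def
    by (rule interpolation_inequality[OF J R card \<rho> small x_def])
  then have "C \<le> A * (fact (5 * K) * B)" using C0 by (simp add: field_simps)
  also have "\<dots> \<le> A * (real (5 * K) ^ (5 * K) * B)"
    using A0 B0 fact_le_power[of "5 * K", where 'a = real] by simp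
  finally have "ln C \<le> ln (A * (real (5 * K) ^ (5 * K) * B))" using C0 by simp
  also have "\<dots> = ln A + (5 * K * ln (real (5 * K)) + ln B)"
    using A0 B0 K by (simp add: ln_mult ln_realpow distrib_left)
  finally have main: "ln C \<le> ln A + (5 * K * ln (real (5 * K)) + ln B)" .
  have lnC: "ln C = 5 * real K * (5 * real K - 1) / 2 * ln \<rho>"
  proof -
    have "real (\<Sum>{..<n}) = real n * (real n - 1) / 2" for n
      by (induction n) (auto simp: field_simps)
    then show ?thesis using \<rho> by (simp add: C_def ln_realpow)
  qed
  have lnA: "ln A = 6 * real K * J * ln y"
  proof -
    have "ln A = (\<Sum>m<5 * K. real J * ln y * real (hyp_freq (m mod 5)))"
      unfolding A_def using y_gt_1 by (subst ln_prod) (auto simp: ln_realpow intro!: sum.cong)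
    also have "\<dots> = (\<Sum>k<K. \<Sum>l<5. real J * ln y * real (hyp_freq l))"
      using sum_div_mod_5[of "\<lambda>k l. real J * ln y * real (hyp_freq l)" K] by simp
    also have "\<dots> = 6 * real K * J * ln y"
      unfolding sum_distrib_left[symmetric] sum_hyp_freq by simp
    finally show ?thesis .
  qed
  have lnB: "ln B \<le> 5 * K * ln 2 + 5 * (real K * (real K - 1) / 2 * ln W - (\<Sum>k<K. ln (fact k)))
      + 6 * real K * (u * \<rho> * X)"
  proof -
    have "ln B = (\<Sum>m<5 * K. ln (G m))"
      unfolding B_def by (subst ln_prod) (auto simp: G0 less_imp_neq[OF G0, THEN not_sym])
    also have "\<dots> \<le> (\<Sum>m<5 * K. ln 2 + (real (m div 5) * ln W - ln (fact (m div 5)))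
        + real (hyp_freq (m mod 5)) * (u / p * x))"
    proof (rule sum_mono)
      fix m assume "m \<in> {..<5 * K}"
      then have k: "m div 5 < K" by auto
      define k where "k = m div 5"
      have "(\<Prod>i<k. x + real i) \<le> (\<Prod>i<k. W)"
        using x0 k by (intro prod_mono) (auto simp: Wx k_def)
      then have "ln (\<Prod>i<k. x + real i) \<le> ln (W ^ k)" using P0[of k] by simp
      also have "\<dots> = k * ln W" using x0 by (simp add: ln_realpow Wx)
      finally have 1: "ln (\<Prod>i<k. x + real i) \<le> k * ln W" .
      have "ln (2 * (P / f * exp e)) = ln 2 + (ln P - ln f) + e" if "P > 0" "f > 0" for P f e :: real
        using that by (simp add: ln_mult ln_div)
      from this[OF P0[of k] fact_gt_zero[of k]]
      have "ln (G m) = ln 2 + (ln (\<Prod>i<k. x + real i) - ln (fact k)) + real (hyp_freq (m mod 5)) * (u / p * x)"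
        by (simp add: G_def k_def)
      then show "ln (G m) \<le> ln 2 + (real (m div 5) * ln W - ln (fact (m div 5)))
          + real (hyp_freq (m mod 5)) * (u / p * x)"
        using 1 by (simp add: k_def)
    qed
    also have "\<dots> = (\<Sum>k<K. \<Sum>l<5. ln 2 + (real k * ln W - ln (fact k)) + real (hyp_freq l) * (u / p * x))"
      by (rule sum_div_mod_5)
    also have "\<dots> = (\<Sum>k<K. 5 * ln 2 + 5 * (real k * ln W - ln (fact k)) + 6 * (u / p * x))"
    proof (rule sum.cong[OF refl])
      have inner: "(\<Sum>l<5. s + real (hyp_freq l) * w) = 5 * s + 6 * w" for s w
        unfolding sum.distrib sum_distrib_right[symmetric] sum_hyp_freq by simp
      show "(\<Sum>l<5. ln 2 + (real k * ln W - ln (fact k)) + real (hyp_freq l) * (u / p * x))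
        = 5 * ln 2 + 5 * (real k * ln W - ln (fact k)) + 6 * (u / p * x)" for k
        unfolding inner by simp
    qed
    also have "\<dots> = 5 * K * ln 2 + 5 * ((\<Sum>k<K. real k) * ln W - (\<Sum>k<K. ln (fact k))) + 6 * real K * (u / p * x)"
      by (simp add: sum.distrib sum_subtractf sum_distrib_left[symmetric] sum_distrib_right[symmetric])
    also have "(\<Sum>k<K. real k) = real K * (real K - 1) / 2"
      by (induction K) (auto simp: field_simps)
    also have "u / p * x = u * \<rho> * X" using p_pos by (simp add: x_def X)
    finally show ?thesis .
  qed
  have sf: "(real K - 1)\<^sup>2 / 2 * (ln (real K - 1) - 3 / 2) \<le> (\<Sum>k<K. ln (fact k))"
    using superfactorial_lower_bound[of "K - 1"] K by (simp add: of_nat_diff)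
  have "ln (10 * real K) = ln 2 + ln (real (5 * K))" using K ln_mult[of 2 "5 * real K"] by simp
  then have "5 * real K * ln (10 * real K) = 5 * K * ln 2 + 5 * K * ln (real (5 * K))"
    by (simp add: algebra_simps)
  then show ?thesis using main lnB sf unfolding lnC lnA by argo
qed

lemma form_not_small:
  assumes p: "p \<ge> 1952" and y: "y \<ge> 7" and small: "\<bar>form\<bar> \<le> 4 / exp (p * ln y / 2)"
  shows False
proof -
  define Y where "Y = ln (real_of_int y)"
  have Y: "Y \<ge> 19 / 10"
  proof -
    have "ln 7 \<le> Y" unfolding Y_def using y by simp
    then show ?thesis using ln_bounds(3) by linarith
  qed
  define \<rho> where "\<rho> = real p / 122"
  have rho: "\<rho> \<ge> 16" using p by (simp add: \<rho>_def)
  define lam where "lam = ln \<rho>"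
  have lam: "lam \<ge> 11 / 4"
  proof -
    have "ln 16 \<le> lam" unfolding lam_def using rho by simp
    then show ?thesis using ln_bounds(1) by linarith
  qed
  \<comment> \<open>\<open>K\<close> is the largest integer with \<open>\<rho> ^ (5 * K) \<le> y powr (p / 2)\<close>; \<open>R\<close> balances the archimedean
    contribution \<open>u \<rho> X\<close> against the denominators \<open>y ^ J\<close>.\<close>
  define q where "q = p * Y / (10 * lam)"
  define K where "K = nat \<lfloor>q\<rfloor>"
  define R where "R = nat \<lceil>3 * Y\<rceil>"
  define H where "H = nat \<lceil>5 * real K / (2 * real R)\<rceil>"
  \<comment> \<open>This makes \<open>2 * J - 3\<close> equal to \<open>2 * H + 1\<close>, so that
    \<open>(2 * J - 3) * R\<close> is at least \<open>5 * K + R\<close>.\<close>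
  define J where "J = H + 2"
  have "q \<ge> 1"
  proof -
    have "lam \<le> \<rho> - 1" unfolding lam_def using rho by (intro ln_le_minus_one) simp
    then have "10 * lam \<le> real p * 1" by (simp add: \<rho>_def)
    also have "\<dots> \<le> p * Y" using Y by (intro mult_left_mono) auto
    finally show ?thesis using lam by (simp add: q_def)
  qed
  then have K: "real K \<le> q" "real K \<ge> q - 1" "K \<ge> 1" unfolding K_def by linarith+
  have R: "real R \<ge> 3 * Y" "real R \<le> 3 * Y + 1" "R \<ge> 1" using Y unfolding R_def by linarith+
  have "5 * real K / (2 * real R) \<ge> 0" by simp
  then have H: "real H \<ge> 5 * real K / (2 * real R)" "real H \<le> 5 * real K / (2 * real R) + 1"
    unfolding H_def by linarith+
  have J: "real J \<le> 5 * real K / (2 * real R) + 3" using H by (simp add: J_def)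
  have u: "0 \<le> u" "u \<le> 9 / 5"
  proof -
    show "0 \<le> u" by (rule u_nonneg)
    have "sqrt 2 \<le> 1415 / 1000" by (rule real_le_lsqrt) (auto simp: power2_eq_square)
    then have "exp u \<le> 583 / 100" unfolding exp_u by simp
    then have "ln (exp u) \<le> ln (583 / 100)" by (subst ln_le_cancel_iff) auto
    then show "u \<le> 9 / 5" using ln_bounds(4) by simp
  qed
  \<comment> \<open>Besides \<open>2 * J < p\<close> this gives the factor 1/2 in the bound for
    \<open>t\<close> below.\<close>
  have J16: "16 * real J \<le> p"
  proof -
    have "5 * real K / (2 * real R) \<le> 5 * q / (2 * (3 * Y))"
      using K(1) R Y by (intro frac_le) auto
    also have "\<dots> = p / (12 * lam)" using Y lam by (simp add: q_def field_simps)
    also have "\<dots> \<le> p / 33" using lam by (intro divide_left_mono) auto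
    finally show ?thesis using J p by simp
  qed
  define E where "E = exp (p * Y / 2)"
  have E1: "E \<ge> 1" using Y by (simp add: E_def)
  have \<rho>E: "\<rho> ^ (5 * K) \<le> E"
  proof -
    have "\<rho> ^ (5 * K) = exp (real (5 * K) * lam)"
      unfolding exp_of_nat_mult using rho by (simp add: lam_def)
    also have "real (5 * K) * lam \<le> p * Y / 2"
    proof -
      have "real K * lam \<le> q * lam" using K lam by (intro mult_right_mono) auto
      also have "\<dots> = p * Y / 10" using lam by (simp add: q_def)
      finally show ?thesis by simp
    qed
    finally show ?thesis by (simp add: E_def)
  qed
  define t where "t = 2 * J * \<bar>form\<bar> / p"
  have t: "t \<le> 1 / (2 * E)" "t \<ge> 0"
  proof -
    have "t \<le> 2 * J * (4 / E) / p"
      unfolding t_def using small by (intro divide_right_mono mult_left_mono) (auto simp: E_def Y_def)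
    also have "\<dots> = (16 * real J) / p * (1 / (2 * E))" by simp
    also have "\<dots> \<le> 1 * (1 / (2 * E))"
      using J16 p E1 by (intro mult_right_mono) auto
    finally show "t \<le> 1 / (2 * E)" by simp
    show "t \<ge> 0" by (simp add: t_def)
  qed
  \<comment> \<open>The factor 1/2 absorbs the loss in \<open>exp t - 1 \<le> 2 * t\<close>, valid
    for t in [0, 1].\<close>
  have "1 / (2 * E) \<le> 1 / 2" using E1 by simp
  then have "t \<le> 1" using t by linarith
  then have "exp t \<le> 1 + t + t\<^sup>2" using t by (intro exp_bound)
  also have "t\<^sup>2 \<le> t" using t \<open>t \<le> 1\<close> by (simp add: power2_eq_square mult_left_le)
  finally have "exp t - 1 \<le> 1 / E" using t by simp
  also have "\<dots> \<le> 1 / \<rho> ^ (5 * K)"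
    using \<rho>E rho E1 by (intro divide_left_mono) auto
  finally have sm: "exp (2 * J * \<bar>form\<bar> / p) - 1 \<le> 1 / \<rho> ^ (5 * K)" by (simp add: t_def)
  have card: "(2 * J - 3) * R > (K - 1) * 5"
  proof -
    have "5 * real K \<le> 2 * real H * real R" using H(1) R(3) by (simp add: field_simps)
    then have "5 * K \<le> 2 * H * R" by (metis of_nat_le_iff of_nat_mult of_nat_numeral)
    moreover have "(2 * J - 3) * R = 2 * H * R + R" by (simp add: J_def algebra_simps)
    ultimately show ?thesis using R(3) K(3) by simp
  qed
  show False
  proof (rule parameter_contradiction[of p Y \<rho> lam K R J u])
    show "5 * real K * (5 * real K - 1) / 2 * lam \<le> 6 * real K * J * Y + 5 * real K * ln (10 * real K)
      + 5 * (real K * (real K - 1) / 2 * ln (\<rho> * (p * (R / 2 + 1)) + K)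
      - (real K - 1)\<^sup>2 / 2 * (ln (real K - 1) - 3 / 2)) + 6 * real K * (u * \<rho> * (R / 2 + 1))"
      unfolding Y_def lam_def
      by (rule log_inequality[OF _ _ R(3) card _ sm refl refl K(3)])
        (use J16 p rho in \<open>simp_all add: J_def\<close>)
  qed (use p Y R J u K in \<open>simp_all add: \<rho>_def lam_def q_def\<close>)
qed

end

section \<open>Reduction of the equation to the linear form\<close>

text \<open>Odd squares are 1 modulo 8, so \<open>y\<close> is congruent to y^p = x^2 - 2, that is,
  to 7. For y at most -2, y^p would be at most -2 as well, so x^2 would not be positive, although
  \<open>x\<close> is odd.\<close>

lemma seven_le_base:
  fixes x y :: int
  assumes eq: "x\<^sup>2 - 2 = y ^ p" and p: "odd p" "p > 1" and y: "y \<noteq> - 1"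
  shows "y \<ge> 7"
proof -
  obtain k where k: "p = 2 * k + 1" using p(1) by (auto elim: oddE)
  have xodd: "odd x" by (rule odd_of_square_minus_2_eq_power[OF eq p(2)])
  have sq: "z\<^sup>2 mod 8 = 1" if "odd z" for z :: int
  proof -
    obtain j where j: "z = 2 * j + 1" using \<open>odd z\<close> by (rule oddE)
    have "even (j * (j + 1))" by simp
    then obtain i where i: "j * (j + 1) = 2 * i" by (rule evenE)
    have "z\<^sup>2 = 4 * (j * (j + 1)) + 1" by (simp add: j power2_eq_square algebra_simps)
    then have "z\<^sup>2 = 8 * i + 1" unfolding i by simp
    then show ?thesis by presburger
  qed
  have yodd: "odd y"
  proof
    assume "even y"
    then have "even (y ^ p)" using p by simp
    then show False unfolding eq[symmetric] using xodd by simp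
  qed
  have "(y\<^sup>2) ^ k mod 8 = 1" using power_mod[of "y\<^sup>2" 8 k] sq[OF yodd] by simp
  then have "(y * (y\<^sup>2) ^ k) mod 8 = y mod 8" by (metis mod_mult_right_eq mult.right_neutral)
  moreover have "y ^ p = y * (y\<^sup>2) ^ k" by (simp add: k power_mult[symmetric])
  ultimately have "y mod 8 = (x\<^sup>2 - 2) mod 8" unfolding eq by simp
  then have y8: "y mod 8 = 7" using sq[OF xodd] by presburger
  have "y > - 2"
  proof (rule ccontr)
    assume "\<not> y > - 2"
    then have "2 \<le> - y" by simp
    have "- y \<le> (- y) ^ p" using \<open>2 \<le> - y\<close> p by (intro self_le_power) auto
    also have "\<dots> = - (y ^ p)" using p(1) by simp
    finally have "x\<^sup>2 \<le> 0" using \<open>2 \<le> - y\<close> eq by linarith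
    then show False using xodd by simp
  qed
  then show ?thesis using y8 y by presburger
qed

lemma ln_power_int: "ln (x powi n) = of_int n * ln (x :: real)"
  by (simp add: power_int_def ln_realpow ln_inverse)

theorem theorem5p17:
  fixes p :: nat and x y :: int
  assumes "prime p" and "p > 1951" and "x^2 - 2 = y^p"
  shows "y = -1"
proof (rule ccontr)
  assume yne: "y \<noteq> - 1"
  have p: "odd p" "p > 1" using assms(1,2) prime_odd_nat[of p] by auto
  have y7: "y \<ge> 7" by (rule seven_le_base[OF assms(3) p yne])
  have y0: "real_of_int y > 0" using y7 by simp
  \<comment> \<open>With |x| in place of \<open>x\<close>, both z + sqrt 2 and z - sqrt 2 are
    positive and have logarithms.\<close>
  define z where "z = \<bar>x\<bar>"
  have z: "z\<^sup>2 - 2 = y ^ p" using assms(3) by (simp add: z_def)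
  \<comment> \<open>This is y^(p/2), just below \<open>z\<close>.\<close>
  define E where "E = exp (p * ln y / 2)"
  have "E ^ 2 = exp (real p * ln y)" by (simp add: E_def power2_eq_square exp_add[symmetric])
  also have "\<dots> = real_of_int y ^ p" using y0 by (simp add: exp_of_nat_mult)
  finally have E2: "E\<^sup>2 = y ^ p" by simp
  have zE: "(real_of_int z)\<^sup>2 = E\<^sup>2 + 2"
    using arg_cong[OF z, of real_of_int] E2 by simp
  have yE: "E \<ge> y"
  proof -
    have "real_of_int y = exp (2 * ln y / 2)" using y0 by simp
    also have "\<dots> \<le> E" unfolding E_def using p y7
      by (intro exp_le_cancel_iff[THEN iffD2] divide_right_mono mult_right_mono) auto
    finally show ?thesis .
  qed
  have z_ge: "real_of_int z \<ge> E" by (rule power2_le_imp_le) (simp only: zE, simp, simp add: z_def)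
  have z7: "real_of_int z \<ge> 7" using z_ge yE y7 by linarith
  obtain a b r :: int where r: "2 * \<bar>r\<bar> < int p" and ab: "\<bar>a\<^sup>2 - 2 * b\<^sup>2\<bar> = \<bar>y\<bar>"
    and plus: "z + sqrt 2 = (1 + sqrt 2) powi r * (a + b * sqrt 2) ^ p"
    and minus: "z - sqrt 2 = (1 - sqrt 2) powi r * (a - b * sqrt 2) ^ p"
    using zsqrt2_factorisation[OF z p] by blast
  define \<alpha> \<alpha>' where "\<alpha> = a + b * sqrt 2" and "\<alpha>' = a - b * sqrt 2"
  have "\<alpha> * \<alpha>' = of_int (a\<^sup>2 - 2 * b\<^sup>2)" by (simp add: \<alpha>_def \<alpha>'_def algebra_simps power2_eq_square)
  then have "\<bar>\<alpha> * \<alpha>'\<bar> = of_int \<bar>a\<^sup>2 - 2 * b\<^sup>2\<bar>" by simp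
  also have "\<dots> = y" using ab y7 by simp
  finally have \<alpha>y: "\<bar>\<alpha>\<bar> * \<bar>\<alpha>'\<bar> = y" by (simp add: abs_mult)
  have \<alpha>0: "\<bar>\<alpha>\<bar> > 0" "\<bar>\<alpha>'\<bar> > 0" using \<alpha>y y0 by auto
  define u where "u = ln (3 + 2 * sqrt 2)"
  have exp_u: "exp u = 3 + 2 * sqrt 2" unfolding u_def by (rule exp_ln) (simp add: add_pos_pos)
  have "(1 + sqrt 2)\<^sup>2 = 3 + 2 * sqrt 2" by (simp add: power2_eq_square algebra_simps)
  then have u2: "ln (1 + sqrt 2) = u / 2"
    unfolding u_def using ln_realpow[of "1 + sqrt 2" 2] by (simp add: add_pos_pos)
  have conj: "\<bar>1 - sqrt 2\<bar> = inverse (1 + sqrt 2)"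
  proof (rule inverse_unique[symmetric])
    have "\<bar>1 - sqrt 2\<bar> = sqrt 2 - 1" using sqrt2_bounds by simp
    then show "(1 + sqrt 2) * \<bar>1 - sqrt 2\<bar> = 1" by (simp add: algebra_simps)
  qed
  define v where "v = ln (\<bar>\<alpha>\<bar> / \<bar>\<alpha>'\<bar>)"
  have exp_v: "exp v = \<bar>\<alpha>\<bar> / \<bar>\<alpha>'\<bar>" unfolding v_def using \<alpha>0 by (intro exp_ln divide_pos_pos)
  have yv: "y * exp v = \<alpha>\<^sup>2" "y * exp (- v) = \<alpha>'\<^sup>2"
    using \<alpha>0 by (simp_all add: exp_v exp_minus \<alpha>y[symmetric] power2_eq_square field_simps)
  have s2: "1 + sqrt 2 > 0" by (simp add: add_pos_pos)
  \<comment> \<open>Absolute values remove the unknown signs of \<open>\<alpha>\<close> and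
    \<open>\<alpha>'\<close>; the difference of the two logarithms is the linear form.\<close>
  have lnplus: "ln (z + sqrt 2) = r * (u / 2) + p * ln \<bar>\<alpha>\<bar>"
  proof -
    have "z + sqrt 2 = \<bar>z + sqrt 2\<bar>" using z7 sqrt2_bounds by linarith
    also have "\<dots> = \<bar>(1 + sqrt 2) powi r * \<alpha> ^ p\<bar>" by (simp only: plus \<alpha>_def)
    also have "\<dots> = (1 + sqrt 2) powi r * \<bar>\<alpha>\<bar> ^ p"
      using s2 by (simp add: abs_mult power_abs)
    also have "ln \<dots> = ln ((1 + sqrt 2) powi r) + ln (\<bar>\<alpha>\<bar> ^ p)"
      using s2 \<alpha>0 by (intro ln_mult_pos zero_less_power zero_less_power_int) auto
    finally show ?thesis using \<alpha>0 s2 by (simp add: ln_realpow ln_power_int u2)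
  qed
  have lnminus: "ln (z - sqrt 2) = - (r * (u / 2)) + p * ln \<bar>\<alpha>'\<bar>"
  proof -
    have "z - sqrt 2 = \<bar>z - sqrt 2\<bar>" using z7 sqrt2_bounds by linarith
    also have "\<dots> = \<bar>(1 - sqrt 2) powi r * \<alpha>' ^ p\<bar>" by (simp only: minus \<alpha>'_def)
    also have "\<dots> = inverse (1 + sqrt 2) powi r * \<bar>\<alpha>'\<bar> ^ p"
      by (simp add: abs_mult power_abs power_int_abs conj)
    also have "ln \<dots> = ln (inverse (1 + sqrt 2) powi r) + ln (\<bar>\<alpha>'\<bar> ^ p)"
      using s2 \<alpha>0 by (intro ln_mult_pos zero_less_power zero_less_power_int) auto
    finally show ?thesis using \<alpha>0 s2 by (simp add: ln_realpow ln_power_int ln_inverse u2)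
  qed
  have form: "r * u + p * v = ln ((z + sqrt 2) / (z - sqrt 2))"
  proof -
    have "ln ((z + sqrt 2) / (z - sqrt 2)) = ln (z + sqrt 2) - ln (z - sqrt 2)"
      using z7 sqrt2_bounds by (intro ln_divide_pos) auto
    moreover have v: "v = ln \<bar>\<alpha>\<bar> - ln \<bar>\<alpha>'\<bar>"
      unfolding v_def using \<alpha>0 by (intro ln_divide_pos) auto
    ultimately show ?thesis unfolding lnplus lnminus v by (simp add: algebra_simps)
  qed
  have form_pos: "r * u + p * v > 0"
    unfolding form using z7 sqrt2_bounds by (simp add: field_simps)
  have form_le: "r * u + p * v \<le> 4 / E"
  proof -
    have "r * u + p * v \<le> (z + sqrt 2) / (z - sqrt 2) - 1"
      unfolding form using z7 sqrt2_bounds by (intro ln_le_minus_one divide_pos_pos) auto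
    also have "\<dots> = 2 * sqrt 2 / (z - sqrt 2)" using z7 sqrt2_bounds by (simp add: field_simps)
    also have "\<dots> \<le> 4 / z"
    proof -
      have "2 * sqrt 2 * z \<le> 3 * real_of_int z" using z7 sqrt2_bounds by (intro mult_right_mono) auto
      also have "\<dots> \<le> 4 * (z - sqrt 2)" using z7 sqrt2_bounds by (simp add: right_diff_distrib)
      finally have "2 * sqrt 2 * z \<le> 4 * (z - sqrt 2)" .
      moreover have "z - sqrt 2 > 0" "real_of_int z > 0" using z7 sqrt2_bounds by linarith+
      ultimately show ?thesis
        by (simp only: pos_divide_le_eq times_divide_eq_left pos_le_divide_eq)
    qed
    also have "\<dots> \<le> 4 / E" using z_ge yE y0 by (intro divide_left_mono) auto
    finally show ?thesis .
  qed
  \<comment> \<open>For r = 0 the form is p v, so v is positive and at most 4 / (1951 E). Then y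
    (exp v - exp (-v)) = 4 a b sqrt 2 is at least 4, because a b is a positive integer, yet it is at
    most 3 E v.\<close>
  have r0: "r \<noteq> 0"
  proof
    assume "r = 0"
    then have v: "v > 0" "p * v \<le> 4 / E" using form_pos form_le p by (auto simp: zero_less_mult_iff)
    have diff: "y * exp v - y * exp (- v) = 4 * of_int (a * b) * sqrt 2"
      unfolding yv \<alpha>_def \<alpha>'_def by (simp add: power2_eq_square algebra_simps)
    have "y * exp (- v) < y * exp v" using y0 v by simp
    then have "real_of_int (a * b) * sqrt 2 > 0" using diff by linarith
    then have "a * b > 0" by (simp add: zero_less_mult_iff)
    then have "real_of_int (a * b) \<ge> 1" by linarith
    then have "1 * 1 \<le> real_of_int (a * b) * sqrt 2" using sqrt2_bounds by (intro mult_mono) auto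
    then have ge: "y * (exp v - exp (- v)) \<ge> 4" using diff by (simp add: algebra_simps)
    have "4 / E \<le> 1" using yE y7 by simp
    moreover have "1951 * v \<le> p * v" using assms(2) v by (intro mult_right_mono) auto
    ultimately have v1: "v \<le> 1" "1951 * v \<le> 4 / E" using v by linarith+
    have "exp v \<le> 1 + v + v\<^sup>2" using v v1 by (intro exp_bound) auto
    moreover have "v\<^sup>2 \<le> v" using v v1 by (simp add: power2_eq_square mult_left_le)
    moreover have "1 - v \<le> exp (- v)" using exp_ge_add_one_self[of "- v"] by simp
    ultimately have "exp v - exp (- v) \<le> 3 * v" by linarith
    then have "y * (exp v - exp (- v)) \<le> E * (3 * v)" using y0 yE v by (intro mult_mono) auto
    moreover have "E * (1951 * v) \<le> 4" using v1(2) yE y0 by (simp add: field_simps)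
    ultimately show False using ge by simp
  qed
  \<comment> \<open>Since 0 < |r| < p / 2. The resulting coprimality keeps the abscissas of the
    interpolation points distinct.\<close>
  have "\<not> int p dvd r"
  proof
    assume "int p dvd r"
    then have "\<bar>int p\<bar> \<le> \<bar>r\<bar>" using r0 by (intro dvd_imp_le_int)
    then show False using r by simp
  qed
  then have cop: "coprime r (int p)"
    using assms(1) prime_imp_coprime[of "int p" r] by (simp add: coprime_commute)
  \<comment> \<open>For v = 0 the positive form would be r u, at least u and hence at least 1, which
    exceeds 4 / E.\<close>
  have v0: "v \<noteq> 0"
  proof
    assume v: "v = 0"
    have "exp 1 \<le> exp u" unfolding exp_u using exp_le sqrt2_bounds by linarith
    then have u1: "u \<ge> 1" by simp
    have "real_of_int r * u > 0" using form_pos v by simp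
    then have "r > 0" using u1 by (simp add: zero_less_mult_iff)
    then have "1 * 1 \<le> real_of_int r * u" using u1 by (intro mult_mono) auto
    moreover have "4 / E < 1" using yE y7 by simp
    ultimately show False using form_le v by simp
  qed
  interpret linear_form p r y a b u v
    by unfold_locales
      (use p cop r y7 exp_u yv v0 in \<open>auto simp: \<alpha>_def \<alpha>'_def\<close>)
  have "\<bar>form\<bar> \<le> 4 / exp (p * ln y / 2)"
    using form_pos form_le by (simp add: form_def E_def)
  then show False using form_not_small assms(2) y7 by simp
qed

end
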